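(* Let $G$ be a graph and let $t=\max\{3,\chi(G)\}$, where $\chi(G)$ denotes the chromatic number of $G$. Then $G$ is uniquely $2$-list colorable if and only if $G$ is uniquely $(2,t)$-list colorable.
   Context: All graphs are finite, undirected and simple. For a graph $G$ and positive integers $k,t$, a $(k,t)$-list assignment to $G$ is a map $L$ that assigns to each vertex $v$ a set $L(v)$ (of colors) of size $k$ such that $|\bigcup_{v\in V(G)}L(v)|=t$. An $L$-coloring of $G$ is a proper vertex coloring $c$ of $G$ with $c(v)\in L(v)$ for every vertex $v$. The graph $G$ is uniquely $(k,t)$-list colorable if there exists a $(k,t)$-list assignment $L$ to $G$ such that $G$ has exactly one $L$-coloring. The graph $G$ is uniquely $k$-list colorable if it is uniquely $(k,t)$-list colorable for some $t$. *)

theory Defs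
  imports "Graph_Theory.Digraph" "HOL-Library.FuncSet"
begin

text \<open>
  The locale \<open>graph\<close> of \<open>Graph_Theory.Digraph\<close> describes finite, symmetric, loop-free digraphs
  without parallel arcs, that is, finite simple graphs; an undirected edge is a pair of opposite
  arcs, and \<open>u \<rightarrow>\<^bsub>G\<^esub> v\<close> is adjacency.  Colours are natural numbers: every list assignment
  considered below uses only finitely many colours, so their names are immaterial.
\<close>

definition proper_coloring :: "('a, 'b) pre_digraph \<Rightarrow> ('a \<Rightarrow> nat) \<Rightarrow> bool" where
  "proper_coloring G c \<longleftrightarrow> (\<forall>u\<in>verts G. \<forall>v\<in>verts G. u \<rightarrow>\<^bsub>G\<^esub> v \<longrightarrow> c u \<noteq> c v)"

definition colorable :: "('a, 'b) pre_digraph \<Rightarrow> nat \<Rightarrow> bool" where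
  "colorable G n \<longleftrightarrow> (\<exists>c. proper_coloring G c \<and> c ` verts G \<subseteq> {..<n})"

definition chromatic_number :: "('a, 'b) pre_digraph \<Rightarrow> nat" where
  "chromatic_number G = (LEAST n. colorable G n)"

definition list_assignment ::
    "nat \<Rightarrow> nat \<Rightarrow> ('a, 'b) pre_digraph \<Rightarrow> ('a \<Rightarrow> nat set) \<Rightarrow> bool" where
  "list_assignment k t G L \<longleftrightarrow>
     0 < k \<and> 0 < t \<and> (\<forall>v\<in>verts G. card (L v) = k) \<and> card (\<Union>v\<in>verts G. L v) = t"

text \<open>
  Functions in \<open>PiE\<close> are \<open>undefined\<close> off \<open>verts G\<close>, so that distinct colourings differ at a vertex.
\<close>

definition list_colorings ::
    "('a, 'b) pre_digraph \<Rightarrow> ('a \<Rightarrow> nat set) \<Rightarrow> ('a \<Rightarrow> nat) set" where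
  "list_colorings G L = {c \<in> PiE (verts G) L. proper_coloring G c}"

definition uniquely_kt_list_colorable ::
    "nat \<Rightarrow> nat \<Rightarrow> ('a, 'b) pre_digraph \<Rightarrow> bool" where
  "uniquely_kt_list_colorable k t G \<longleftrightarrow>
     (\<exists>L. list_assignment k t G L \<and> (\<exists>!c. c \<in> list_colorings G L))"

definition uniquely_list_colorable :: "nat \<Rightarrow> ('a, 'b) pre_digraph \<Rightarrow> bool" where
  "uniquely_list_colorable k G \<longleftrightarrow> (\<exists>t. uniquely_kt_list_colorable k t G)"

end

theory Submission
  imports Defs
begin

text \<open>
  A unique colouring from lists of size two is a colouring \<open>c\<close> together with the second list
  entries \<open>d\<close> such that no nonempty vertex set can be switched from \<open>c\<close> to \<open>d\<close>.  Switching is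
  governed by two rules.  If \<open>u\<close> is switched, then so is every neighbour \<open>v\<close> with \<open>c v = d u\<close>; and
  two adjacent switched vertices must have different \<open>d\<close>.  So \<open>c\<close> is unique iff every nonempty set
  closed under the first rule contains an edge that breaks the second, and to exhibit such a pair \<open>(c, d)\<close>
  it suffices to do so on a small connected part: every other vertex takes as second entry the
  colour of a neighbour nearer to that part (lemma \<open>parents\<close>), and no new colours are needed.

  No unique colouring can use fewer than \<open>max 3 \<chi>\<close> colours: \<open>c\<close> itself uses at least \<open>\<chi>\<close>, and if all
  lists are the same pair, then every vertex can be switched at once.  The content of the theorem is
  that \<open>t = max 3 \<chi>\<close> colours suffice.  By induction on the number of vertices the
  graph may be assumed connected and without cut vertices: a uniquely colourable graph that is glued
  from two parts at one vertex has a uniquely colourable part (\<open>forced_cut_vertex\<close>), and a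
  solution on a part extends to the rest after renaming colours there (\<open>forceable_attach\<close>).  What
  remains is to show, for a graph without cut vertices, that if there is no solution with \<open>t\<close>
  colours, then the graph is complete, complete bipartite or regular of degree two; and these have no
  unique colouring with any number of colours.

  Suppose first \<open>\<chi> \<ge> 3\<close>.  Then \<open>t = \<chi>\<close> colours will do.  Take a proper \<open>t\<close>-colouring whose last colour class is
  smallest possible.  A vertex \<open>z\<close> of that class is linked, for any two other colours, to neighbours
  of both colours in a common Kempe chain, since otherwise \<open>z\<close> could be recoloured (\<open>linked\<close>).  If two
  neighbours of \<open>z\<close> had the same colour, this would give a solution (\<open>forceable_two_like_nbrs\<close>).  So \<open>z\<close>
  has exactly one neighbour in each other colour.  The last colour can then be moved
  like a token from \<open>z\<close> to any neighbour, and hence to every vertex (\<open>token_move\<close>).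
  For \<open>t = 3\<close> the graph is therefore regular of degree two; for \<open>t \<ge> 4\<close> moving the token around
  closed walks shows that neighbours of a vertex are adjacent (\<open>nbrs_adjacent\<close>), as in Brooks' theorem,
  so the graph is complete.

  If the graph is bipartite and \<open>t = 3\<close>, the solutions come from colouring a vertex \<open>p\<close> and the
  non-neighbours of \<open>p\<close> on the opposite side alike, the neighbours of \<open>p\<close> with a second colour, and the
  remaining vertices with a third.  Without solutions, the components left after deleting \<open>p\<close> and its
  neighbours are attached so sparsely that the inner vertices of every induced path on four
  vertices have degree two (\<open>path_mid_degree\<close>).  Either there is no such path and the
  graph is complete bipartite, or the property spreads and all degrees are two.
\<close>

section \<open>Connection inside a vertex set\<close>

locale adjacency =
  fixes E :: "'a \<Rightarrow> 'a \<Rightarrow> bool"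
  assumes adj_sym: "E u v \<Longrightarrow> E v u"
    and adj_irrefl: "\<not> E u u"
begin

definition conn :: "'a set \<Rightarrow> 'a \<Rightarrow> 'a \<Rightarrow> bool" where
  "conn X = (\<lambda>u v. u \<in> X \<and> v \<in> X \<and> E u v)\<^sup>*\<^sup>*"

lemma conn_refl [simp]: "conn X u u"
  by (simp add: conn_def)

lemma conn_trans [trans]: "conn X u v \<Longrightarrow> conn X v w \<Longrightarrow> conn X u w"
  unfolding conn_def by (rule rtranclp_trans)

lemma conn_edge: "u \<in> X \<Longrightarrow> v \<in> X \<Longrightarrow> E u v \<Longrightarrow> conn X u v"
  unfolding conn_def by (rule r_into_rtranclp) simp

lemma conn_sym: "conn X u v \<Longrightarrow> conn X v u"
  unfolding conn_def
  by (erule rtranclp_induct) (auto intro: converse_rtranclp_into_rtranclp adj_sym)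

lemma conn_mono: "conn X u v \<Longrightarrow> X \<subseteq> Y \<Longrightarrow> conn Y u v"
  unfolding conn_def by (erule rtranclp_mono[THEN predicate2D, rotated]) auto

lemma conn_mem: "conn X u v \<Longrightarrow> u \<in> X \<Longrightarrow> v \<in> X"
  unfolding conn_def by (erule rtranclp_induct) auto

lemma conn_induct [consumes 1, case_names refl step]:
  assumes "conn X u v" "P u"
    "\<And>y w. conn X u y \<Longrightarrow> y \<in> X \<Longrightarrow> w \<in> X \<Longrightarrow> E y w \<Longrightarrow> P y \<Longrightarrow> P w"
  shows "P v"
  using assms(1) unfolding conn_def
  by (induction rule: rtranclp_induct) (use assms(2,3) in \<open>auto simp: conn_def\<close>)

lemma conn_converse_induct [consumes 1, case_names refl step]:
  assumes "conn X u v" "P v"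
    "\<And>y w. y \<in> X \<Longrightarrow> w \<in> X \<Longrightarrow> E y w \<Longrightarrow> conn X w v \<Longrightarrow> P w \<Longrightarrow> P y"
  shows "P u"
  using assms(1) unfolding conn_def
  by (induction rule: converse_rtranclp_induct) (use assms(2,3) in \<open>auto simp: conn_def\<close>)

lemma conn_closed:
  assumes "conn X u v" "u \<in> S" "\<And>y w. y \<in> S \<Longrightarrow> y \<in> X \<Longrightarrow> w \<in> X \<Longrightarrow> E y w \<Longrightarrow> w \<in> S"
  shows "v \<in> S"
  using assms by (induction rule: conn_induct) auto

text \<open>
  A connection moves into another set as soon as all vertices reachable from its start lie there.
\<close>

lemma conn_avoid:
  assumes "conn X u v" "\<And>w. conn X u w \<Longrightarrow> w \<in> X \<Longrightarrow> w \<in> Y"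
  shows "conn Y u v"
  using assms(1)
proof (induction rule: conn_induct)
  case (step y w)
  then have "conn X u w"
    using conn_trans conn_edge by blast
  then have "y \<in> Y" "w \<in> Y"
    using step assms(2) by auto
  then show ?case
    using step conn_trans conn_edge by blast
qed simp

text \<open>
  A walk that starts at \<open>w\<close> and eventually visits both \<open>x\<close> and \<open>y\<close> visits one of them first.
  This replaces every argument below that would choose a shortest path or an explicit cycle.
\<close>

lemma conn_first_hit:
  assumes "conn X w x" "x \<noteq> y"
  shows "conn (X - {y}) w x \<or> conn (X - {x}) w y"
  using assms(1)
proof (induction rule: conn_converse_induct)
  case (step u w)
  show ?case
  proof (cases "u = x \<or> u = y")
    case False
    from step.IH show ?thesis
    proof
      assume h: "conn (X - {y}) w x"
      show ?thesis
      proof (cases "w = y")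
        case False
        then show ?thesis
          using h step \<open>\<not> (u = x \<or> u = y)\<close> conn_trans conn_edge[of u "X - {y}" w] by blast
      next
        case True
        then have "conn (X - {x}) u y"
          using step False assms(2) by (intro conn_edge) auto
        then show ?thesis ..
      qed
    next
      assume h: "conn (X - {x}) w y"
      show ?thesis
      proof (cases "w = x")
        case False
        then show ?thesis
          using h step \<open>\<not> (u = x \<or> u = y)\<close> conn_trans conn_edge[of u "X - {x}" w] by blast
      next
        case True
        then have "conn (X - {y}) u x"
          using step False assms(2) by (intro conn_edge) auto
        then show ?thesis ..
      qed
    qed
  qed auto
qed simp

lemma conn_exit:
  assumes "conn Y u v" "u \<in> X" "v \<notin> X"
  shows "\<exists>y w. conn X u y \<and> y \<in> X \<and> y \<in> Y \<and> E y w \<and> w \<in> Y \<and> w \<notin> X"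
proof (rule ccontr)
  assume neg: "\<not> ?thesis"
  have "v \<in> {w. conn X u w \<and> w \<in> X}"
    using assms(1)
  proof (rule conn_closed)
    show "u \<in> {w. conn X u w \<and> w \<in> X}" using assms(2) by simp
    show "w \<in> {w. conn X u w \<and> w \<in> X}"
      if "y \<in> {w. conn X u w \<and> w \<in> X}" "y \<in> Y" "w \<in> Y" "E y w" for y w
    proof -
      have y: "conn X u y" "y \<in> X" using that(1) by simp_all
      have "w \<in> X" using y that(2-4) neg by blast
      with y that(4) have "conn X u w" by (meson conn_edge conn_trans)
      with \<open>w \<in> X\<close> show ?thesis by simp
    qed
  qed
  with assms(3) show False by simp
qed

lemma conn_last_step:
  assumes "conn X u v" "u \<noteq> v"
  shows "\<exists>q\<in>X - {v}. E q v \<and> conn (X - {v}) u q"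
proof -
  have "u \<in> X"
    using assms(2,1) unfolding conn_def by (auto elim: converse_rtranclpE)
  with assms obtain y w where "conn (X - {v}) u y" "y \<in> X - {v}" "E y w" "w \<in> X" "w \<notin> X - {v}"
    using conn_exit[of X u v "X - {v}"] by auto
  then show ?thesis by auto
qed

lemma conn_first_step:
  assumes "conn X u v" "u \<noteq> v"
  shows "u \<in> X \<and> (\<exists>w\<in>X. E u w)"
  using assms unfolding conn_def by (auto elim: converse_rtranclpE)

text \<open>
  Following \<open>par\<close> decreases the distance to \<open>T\<close>.  The second property records where the descent from
  \<open>v\<close> ends in a form that speaks about closed sets only: the end point \<open>w\<close> depends on \<open>v\<close> and \<open>par\<close>,
  but not on the closed set \<open>S\<close>.
\<close>

lemma parents:
  assumes "\<And>v. v \<in> X \<Longrightarrow> \<exists>w\<in>T. conn X v w"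
  obtains par where
    "\<And>v. v \<in> X - T \<Longrightarrow> par v \<in> X \<and> E v (par v)"
    "\<And>v. v \<in> X \<Longrightarrow> \<exists>w\<in>T. \<forall>S. v \<in> S \<longrightarrow> (\<forall>u \<in> S \<inter> (X - T). par u \<in> S) \<longrightarrow> w \<in> S"
proof -
  define R where "R = (\<lambda>u v. u \<in> X \<and> v \<in> X \<and> E u v)"
  define P where "P = (\<lambda>v n. \<exists>w\<in>T. (R ^^ n) v w)"
  define D where "D = (\<lambda>v. LEAST n. P v n)"
  have P: "P v (D v)" if "v \<in> X" for v
  proof -
    have "\<exists>n. P v n"
      using assms[OF that] unfolding conn_def P_def R_def[symmetric]
      by (meson rtranclp_imp_relpowp)
    then show ?thesis unfolding D_def by (rule LeastI_ex)
  qed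
  have ex: "\<exists>u. R v u \<and> D u < D v" if "v \<in> X - T" for v
  proof -
    from P[of v] that obtain w where w: "w \<in> T" "(R ^^ D v) v w"
      by (auto simp: P_def)
    with that obtain m where m: "D v = Suc m"
      by (cases "D v") auto
    with w obtain u where "R v u" "(R ^^ m) u w"
      by (metis relpowp_Suc_D2)
    then have "D u \<le> m"
      unfolding D_def by (intro Least_le) (use w P_def in auto)
    with m \<open>R v u\<close> show ?thesis by auto
  qed
  define par where "par = (\<lambda>v. SOME u. R v u \<and> D u < D v)"
  have par: "R v (par v) \<and> D (par v) < D v" if "v \<in> X - T" for v
    unfolding par_def using someI_ex[OF ex[OF that]] .
  show thesis
  proof (rule that)
    show "par v \<in> X \<and> E v (par v)" if "v \<in> X - T" for v
      using par[OF that] by (auto simp: R_def)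
    show "\<exists>w\<in>T. \<forall>S. v \<in> S \<longrightarrow> (\<forall>u \<in> S \<inter> (X - T). par u \<in> S) \<longrightarrow> w \<in> S" if "v \<in> X" for v
      using that
    proof (induction "D v" arbitrary: v rule: less_induct)
      case less
      show ?case
      proof (cases "v \<in> T")
        case False
        with less.prems have p: "R v (par v)" "D (par v) < D v"
          using par by auto
        then have "par v \<in> X" by (simp add: R_def)
        from less.hyps[OF p(2) this] obtain w where "w \<in> T"
          "\<forall>S. par v \<in> S \<longrightarrow> (\<forall>u \<in> S \<inter> (X - T). par u \<in> S) \<longrightarrow> w \<in> S" by blast
        with False less.prems show ?thesis by blast
      qed blast
    qed
  qed
qed

section \<open>Forced colourings\<close>

definition proper :: "'a set \<Rightarrow> ('a \<Rightarrow> nat) \<Rightarrow> bool" where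
  "proper V c \<longleftrightarrow> (\<forall>u\<in>V. \<forall>v\<in>V. E u v \<longrightarrow> c u \<noteq> c v)"

text \<open>
  \<open>forced V c d\<close> says that \<open>c\<close> is the only colouring of \<open>V\<close> from the lists \<open>{c v, d v}\<close>.  Colourings are
  compared on \<open>V\<close> only, so that they can be restricted and glued freely.
\<close>

definition forced :: "'a set \<Rightarrow> ('a \<Rightarrow> nat) \<Rightarrow> ('a \<Rightarrow> nat) \<Rightarrow> bool" where
  "forced V c d \<longleftrightarrow> proper V c \<and> (\<forall>v\<in>V. d v \<noteq> c v) \<and>
     (\<forall>c'. proper V c' \<longrightarrow> (\<forall>v\<in>V. c' v = c v \<or> c' v = d v) \<longrightarrow> (\<forall>v\<in>V. c' v = c v))"

definition forceable :: "nat \<Rightarrow> 'a set \<Rightarrow> bool" where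
  "forceable t V \<longleftrightarrow> (\<exists>c d. forced V c d \<and> c ` V \<subseteq> {..<t} \<and> d ` V \<subseteq> {..<t})"

lemma properD: "proper V c \<Longrightarrow> u \<in> V \<Longrightarrow> v \<in> V \<Longrightarrow> E u v \<Longrightarrow> c u \<noteq> c v"
  by (simp add: proper_def)

lemma proper_subset: "proper V c \<Longrightarrow> W \<subseteq> V \<Longrightarrow> proper W c"
  by (auto simp: proper_def)

text \<open>
  The two rules for the set \<open>S\<close> of switched vertices: \<open>S\<close> is closed under following second entries, and
  second entries differ along the edges inside \<open>S\<close>.  Together with the converse below, this turns
  uniqueness into a statement about closed sets.
\<close>

lemma forcedI:
  assumes "proper V c" "\<And>v. v \<in> V \<Longrightarrow> d v \<noteq> c v"
    and "\<And>S s. S \<subseteq> V \<Longrightarrow> s \<in> S \<Longrightarrow>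
      (\<And>u v. u \<in> S \<Longrightarrow> v \<in> V \<Longrightarrow> E u v \<Longrightarrow> c v = d u \<Longrightarrow> v \<in> S) \<Longrightarrow>
      (\<And>u v. u \<in> S \<Longrightarrow> v \<in> S \<Longrightarrow> E u v \<Longrightarrow> d u \<noteq> d v) \<Longrightarrow> False"
  shows "forced V c d"
  unfolding forced_def
proof (intro conjI allI impI ballI)
  fix c' v assume c': "proper V c'" "\<forall>v\<in>V. c' v = c v \<or> c' v = d v" and v: "v \<in> V"
  show "c' v = c v"
  proof (rule ccontr)
    assume ne: "c' v \<noteq> c v"
    define S where "S = {v \<in> V. c' v \<noteq> c v}"
    have S: "c' u = d u" "u \<in> V" if "u \<in> S" for u
      using that c'(2) by (auto simp: S_def)
    show False
    proof (rule assms(3))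
      show "S \<subseteq> V" "v \<in> S" using v ne by (auto simp: S_def)
      show "w \<in> S" if "u \<in> S" "w \<in> V" "E u w" "c w = d u" for u w
        using that S[OF that(1)] properD[OF c'(1), of u w] by (auto simp: S_def)
      show "d u \<noteq> d w" if "u \<in> S" "w \<in> S" "E u w" for u w
        using S that properD[OF c'(1), of u w] by auto
    qed
  qed
qed (simp_all add: assms(1,2))

lemma forcedD:
  assumes "forced V c d" "S \<subseteq> V" "s \<in> S"
    and "\<And>u v. u \<in> S \<Longrightarrow> v \<in> V \<Longrightarrow> E u v \<Longrightarrow> c v = d u \<Longrightarrow> v \<in> S"
    and "\<And>u v. u \<in> S \<Longrightarrow> v \<in> S \<Longrightarrow> E u v \<Longrightarrow> d u \<noteq> d v"
  shows False
proof -
  define c' where "c' = (\<lambda>v. if v \<in> S then d v else c v)"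
  have pc: "proper V c" using assms(1) by (simp add: forced_def)
  have "proper V c'"
    unfolding proper_def
  proof (intro ballI impI)
    fix u v assume "u \<in> V" "v \<in> V" "E u v"
    then show "c' u \<noteq> c' v"
      using properD[OF pc, of u v] assms(4)[of u v] assms(4)[of v u] assms(5)[of u v] adj_sym[of u v]
      by (auto simp: c'_def)
  qed
  moreover have "\<forall>v\<in>V. c' v = c v \<or> c' v = d v" by (simp add: c'_def)
  ultimately have "c' s = c s"
    using assms(1,2,3) unfolding forced_def by blast
  moreover have "d s \<noteq> c s" using assms(1,2,3) by (auto simp: forced_def)
  ultimately show False using assms(3) by (simp add: c'_def)
qed

lemma forced_out:
  assumes "forced V c d" "v \<in> V"
  shows "\<exists>w\<in>V. E v w \<and> c w = d v"
proof (rule ccontr)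
  assume "\<not> ?thesis"
  then show False
    using forcedD[OF assms(1), of "{v}" v] assms adj_irrefl by auto
qed

section \<open>Graphs without a forced colouring\<close>

text \<open>
  All colours are different, so each vertex \<open>v\<close> has exactly one neighbour whose colour is \<open>d v\<close>.  A
  smallest nonempty set invariant under this map is permuted by it, hence can be switched: its colours
  are merely permuted.
\<close>

lemma complete_not_forced:
  assumes "finite V" "V \<noteq> {}" "\<And>u v. u \<in> V \<Longrightarrow> v \<in> V \<Longrightarrow> u \<noteq> v \<Longrightarrow> E u v"
  shows "\<not> forced V c d"
proof
  assume F: "forced V c d"
  then have pc: "proper V c" by (simp add: forced_def)
  have inj: "u = v" if "u \<in> V" "v \<in> V" "c u = c v" for u v
    using that assms(3) properD[OF pc] by blast
  obtain f where f: "\<And>v. v \<in> V \<Longrightarrow> f v \<in> V \<and> E v (f v) \<and> c (f v) = d v"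
    using forced_out[OF F] by metis
  define Cs where "Cs = {C. C \<subseteq> V \<and> C \<noteq> {} \<and> f ` C \<subseteq> C}"
  have "V \<in> Cs" using f assms by (auto simp: Cs_def)
  then obtain C where C: "C \<in> Cs" and min: "\<And>C'. C' \<in> Cs \<Longrightarrow> card C \<le> card C'"
    using ex_has_least_nat[of "\<lambda>C. C \<in> Cs" V card] by blast
  have fin: "finite C" using C assms(1) finite_subset by (auto simp: Cs_def)
  have "f ` C \<in> Cs" using C f by (auto simp: Cs_def)
  then have "card C \<le> card (f ` C)" by (rule min)
  with fin have injf: "inj_on f C"
    using card_image_le[OF fin, of f] by (intro eq_card_imp_inj_on) auto
  obtain s where "s \<in> C" using C by (auto simp: Cs_def)
  show False
  proof (rule forcedD[OF F])
    show "C \<subseteq> V" "s \<in> C" using C \<open>s \<in> C\<close> by (auto simp: Cs_def)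
    show "v \<in> C" if "u \<in> C" "v \<in> V" "c v = d u" for u v
    proof -
      have "f u \<in> C" "u \<in> V" using that C by (auto simp: Cs_def)
      moreover have "f u = v" using inj[of "f u" v] f[of u] that \<open>u \<in> V\<close> by auto
      ultimately show ?thesis by simp
    qed
    show "d u \<noteq> d v" if "u \<in> C" "v \<in> C" "E u v" for u v
    proof
      assume "d u = d v"
      moreover have "u \<in> V" "v \<in> V" using that C by (auto simp: Cs_def)
      ultimately have "f u = f v" using f[of u] f[of v] inj by auto
      with injf that have "u = v" by (auto dest: inj_onD)
      with that adj_irrefl show False by simp
    qed
  qed
qed

text \<open>
  Each second entry must occur as a colour on the other side.  As the two sides share no colour, all
  vertices can be switched at the same time.
\<close>

lemma complete_bipartite_not_forced:
  assumes "V \<noteq> {}" "\<And>u v. u \<in> V \<Longrightarrow> v \<in> V \<Longrightarrow> E u v \<longleftrightarrow> side u \<noteq> (side v :: bool)"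
  shows "\<not> forced V c d"
proof
  assume F: "forced V c d"
  then have pc: "proper V c" by (simp add: forced_def)
  obtain s where "s \<in> V" using assms(1) by auto
  show False
  proof (rule forcedD[OF F, of V s])
    show "d u \<noteq> d v" if uv: "u \<in> V" "v \<in> V" "E u v" for u v
    proof
      assume eq: "d u = d v"
      obtain u' v' where "u' \<in> V" "E u u'" "c u' = d u" "v' \<in> V" "E v v'" "c v' = d v"
        using forced_out[OF F] uv by meson
      with eq uv assms(2) properD[OF pc, of u' v'] show False by auto
    qed
  qed (use \<open>s \<in> V\<close> in auto)
qed

text \<open>
  If all vertices cannot be switched at once, some edge \<open>x y\<close> has \<open>d x = d y\<close>.  Walk around the cycle
  starting with \<open>x, y\<close>.  Call step \<open>i\<close> forward if switching \<open>w i\<close> forces the switch of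
  \<open>w (i + 1)\<close>, and backward if the converse holds.  The first step is neither, and the walk returns to
  it.  Take the first later step \<open>j\<close> that is not forward, and go back from it as long as the steps are
  backward: the segment obtained is two-coloured alternately by a single list, and nothing outside it
  is forced, so it can be switched.
\<close>

lemma two_regular_not_forced:
  assumes "finite V" "V \<noteq> {}"
    and reg: "\<And>v. v \<in> V \<Longrightarrow> \<exists>u w. u \<noteq> w \<and> {x \<in> V. E v x} = {u, w}"
  shows "\<not> forced V c d"
proof
  assume F: "forced V c d"
  then have pc: "proper V c" and dc: "\<And>v. v \<in> V \<Longrightarrow> d v \<noteq> c v"
    by (auto simp: forced_def)
  obtain x y where xy: "x \<in> V" "y \<in> V" "E x y" "d x = d y"
    using forcedD[OF F, of V] assms(2) by blast
  (* Pairs (u, v) of adjacent vertices are directed edges, and g is the next edge of the walk;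
     it is injective on a finite set, which makes the walk periodic. *)
  define other where "other = (\<lambda>u v. SOME w. w \<in> V \<and> E v w \<and> w \<noteq> u)"
  have other: "other u v \<in> V \<and> E v (other u v) \<and> other u v \<noteq> u \<and> {x \<in> V. E v x} = {u, other u v}"
    if "u \<in> V" "v \<in> V" "E u v" for u v
  proof -
    obtain a b where ab: "a \<noteq> b" "{x \<in> V. E v x} = {a, b}"
      using reg \<open>v \<in> V\<close> by blast
    have u: "u \<in> {a, b}" using that adj_sym ab(2) by blast
    then have "\<exists>w. w \<in> V \<and> E v w \<and> w \<noteq> u" using ab by blast
    then have *: "other u v \<in> V \<and> E v (other u v) \<and> other u v \<noteq> u"
      unfolding other_def by (rule someI_ex)
    then have "other u v \<in> {a, b}" using ab(2) by blast
    with u * ab show ?thesis by auto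
  qed
  define g where "g = (\<lambda>(u, v). (v, other u v))"
  define D where "D = {(u, v). u \<in> V \<and> v \<in> V \<and> E u v}"
  have gD: "g q \<in> D" if "q \<in> D" for q
    using that other by (auto simp: g_def D_def)
  have ginj: "q = q'" if qs: "q \<in> D" "q' \<in> D" "g q = g q'" for q q'
  proof -
    obtain u v u' where q: "q = (u, v)" "q' = (u', v)" "other u v = other u' v"
      using qs(3) by (cases q; cases q') (auto simp: g_def)
    have "u \<in> V" "u' \<in> V" "v \<in> V" "E u v" "E u' v"
      using that q by (auto simp: D_def)
    then have "{u, other u v} = {u', other u' v}" "other u v \<noteq> u" "other u' v \<noteq> u'"
      using other[of u v] other[of u' v] by auto
    with q show ?thesis by auto
  qed
  define p where "p = (\<lambda>i. (g ^^ i) (x, y))"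
  define w where "w = (\<lambda>i. fst (p i))"
  have pD: "p i \<in> D" for i
    by (induction i) (use xy gD in \<open>auto simp: p_def D_def\<close>)
  have pSuc: "p (Suc i) = g (p i)" for i by (simp add: p_def)
  have p_eq: "p i = (w i, w (Suc i))" for i
    by (simp add: w_def pSuc g_def split: prod.splits)
  have wV: "w i \<in> V" and wE: "E (w i) (w (Suc i))" for i
    using pD[of i] by (auto simp: p_eq D_def)
  have wN: "{v \<in> V. E (w (Suc i)) v} = {w i, w (Suc (Suc i))}" for i
  proof -
    have "w (Suc (Suc i)) = other (w i) (w (Suc i))"
      using pSuc[of i] by (simp add: p_eq g_def)
    then show ?thesis using other[of "w i" "w (Suc i)"] wV wE by auto
  qed
  have w01: "w 0 = x" "w 1 = y"
    using p_eq[of 0] by (auto simp: p_def)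
  have cancel: "p i = p (i + k) \<Longrightarrow> p 0 = p k" for i k
  proof (induction i)
    case (Suc i)
    then have "g (p i) = g (p (i + k))" by (simp add: pSuc)
    then have "p i = p (i + k)" using ginj pD by blast
    with Suc.IH show ?case .
  qed simp
  have "finite D"
    by (rule finite_subset[of _ "V \<times> V"]) (use assms(1) in \<open>auto simp: D_def\<close>)
  then have "finite (range p)"
    by (rule finite_subset[rotated]) (use pD in auto)
  then have "\<not> inj p" using finite_imageD by blast
  then obtain i j where "p i = p j" "i < j"
    unfolding inj_def by (metis linorder_neqE_nat)
  then have "p 0 = p (j - i)" using cancel[of i "j - i"] by simp
  then obtain n where n: "n \<ge> 1" "p n = p 0"
    using \<open>i < j\<close> by (metis One_nat_def Suc_leI zero_less_diff)
  define R where "R = (\<lambda>i. d (w i) = c (w (Suc i)))"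
  define L where "L = (\<lambda>i. d (w (Suc i)) = c (w i))"
  have "\<not> R 0" "\<not> L 0"
    using xy dc[of x] dc[of y] w01 by (auto simp: R_def L_def)
  moreover have "R n \<longleftrightarrow> R 0"
    using n(2) by (simp add: R_def p_eq)
  ultimately have "n \<ge> 1 \<and> \<not> R n" using n by simp
  then obtain j where j: "j \<ge> 1" "\<not> R j" and jmin: "\<And>i. 1 \<le> i \<Longrightarrow> i < j \<Longrightarrow> R i"
    using exists_least_iff[of "\<lambda>j. j \<ge> 1 \<and> \<not> R j"] by auto
  (* The segment from s to j is the longest one ending in j whose steps are all backward;
     they are all forward as well, because j is the first exception. *)
  define P where "P = (\<lambda>s. \<forall>i. s \<le> i \<and> i < j \<longrightarrow> L i)"
  define s where "s = (LEAST s. P s)"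
  have "P j" by (auto simp: P_def)
  then have Ps: "P s" and sj: "s \<le> j"
    unfolding s_def by (auto intro: LeastI Least_le)
  have "s \<noteq> 0"
  proof
    assume "s = 0"
    with Ps j(1) have "L 0" by (simp add: P_def)
    with \<open>\<not> L 0\<close> show False by simp
  qed
  then obtain s' where s': "s = Suc s'" by (cases s) auto
  have "\<not> L s'"
  proof
    assume "L s'"
    then have "P s'" using Ps unfolding P_def s' by (metis le_antisym not_less_eq_eq)
    then have "s \<le> s'" unfolding s_def by (rule Least_le)
    with s' show False by simp
  qed
  have lists: "{c (w i), d (w i)} = {c (w s), d (w s)}" if "s \<le> i" "i \<le> j" for i
    using that
  proof (induction i rule: dec_induct)
    case (step i)
    then have "R i" "L i"
      using jmin s' Ps by (auto simp: P_def)
    then show ?case using step by (auto simp: R_def L_def)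
  qed simp
  define S where "S = w ` {s..j}"
  show False
  proof (rule forcedD[OF F, of S "w s"])
    show "S \<subseteq> V" "w s \<in> S" using wV sj by (auto simp: S_def)
    show "v \<in> S" if uv: "u \<in> S" "v \<in> V" "E u v" "c v = d u" for u v
    proof -
      obtain i where i: "u = w i" "s \<le> i" "i \<le> j" using uv(1) by (auto simp: S_def)
      then obtain i' where i': "i = Suc i'" using s' by (cases i) auto
      have "v \<in> {w i', w (Suc i)}" using wN[of i'] uv i i' by blast
      then show ?thesis
      proof
        assume v: "v = w i'"
        with uv i i' have "L i'" by (simp add: L_def)
        then have "i' \<noteq> s'" using \<open>\<not> L s'\<close> by auto
        then show ?thesis using v i i' s' by (auto simp: S_def)
      next
        assume "v \<in> {w (Suc i)}"
        then have v: "v = w (Suc i)" by simp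
        with uv i have "R i" by (simp add: R_def)
        then have "i \<noteq> j" using j by auto
        then show ?thesis using v i s' by (auto simp: S_def)
      qed
    qed
    show "d u \<noteq> d v" if uv: "u \<in> S" "v \<in> S" "E u v" for u v
    proof
      assume "d u = d v"
      moreover have "u \<in> V" "v \<in> V" using uv wV by (auto simp: S_def)
      moreover have "{c v', d v'} = {c (w s), d (w s)}" if "v' \<in> S" for v'
        using that lists unfolding S_def by fastforce
      then have "{c u, d u} = {c v, d v}" using uv by metis
      ultimately show False using dc properD[OF pc, of u v] uv(3) by (auto simp: doubleton_eq_iff)
    qed
  qed
qed

section \<open>A forced colouring from a Kempe chain\<close>

definition exchange :: "nat \<Rightarrow> nat \<Rightarrow> nat \<Rightarrow> nat" where
  "exchange a b n = (if n = a then b else if n = b then a else n)"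

lemma proper_kempe:
  assumes "proper V c"
    and "\<And>u v. u \<in> Q \<Longrightarrow> v \<in> V \<Longrightarrow> E u v \<Longrightarrow> c v = a \<or> c v = b \<Longrightarrow> v \<in> Q"
    and "\<And>u. u \<in> Q \<Longrightarrow> c u = a \<or> c u = b"
  shows "proper V (\<lambda>v. if v \<in> Q then exchange a b (c v) else c v)"
  unfolding proper_def
proof (intro ballI impI)
  fix u v assume uv: "u \<in> V" "v \<in> V" "E u v"
  have "c u \<noteq> c v" using properD[OF assms(1)] uv by simp
  moreover have "u \<in> Q \<Longrightarrow> v \<notin> Q \<Longrightarrow> c v \<noteq> a \<and> c v \<noteq> b" using assms(2) uv by blast
  moreover have "v \<in> Q \<Longrightarrow> u \<notin> Q \<Longrightarrow> c u \<noteq> a \<and> c u \<noteq> b" using assms(2) uv adj_sym by blast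
  ultimately show "(if u \<in> Q then exchange a b (c u) else c u) \<noteq> (if v \<in> Q then exchange a b (c v) else c v)"
    using assms(3)[of u] assms(3)[of v] by (auto simp: exchange_def)
qed

text \<open>
  The Kempe chains in the colours \<open>a\<close> and \<open>b\<close> are the classes of \<open>conn (kempe V c a b)\<close>.
\<close>

definition kempe :: "'a set \<Rightarrow> ('a \<Rightarrow> nat) \<Rightarrow> nat \<Rightarrow> nat \<Rightarrow> 'a set" where
  "kempe V c a b = {v \<in> V. c v = a \<or> c v = b}"

text \<open>
  The forcing pattern behind the case \<open>\<chi> \<ge> 3\<close>.  Every second entry on the Kempe chain is the other
  chain colour, except that the vertex \<open>ret\<close> points out of the chain to \<open>z\<close>.  Hence switching anything
  switches some chain vertex, then \<open>ret\<close>, then \<open>z\<close>, then \<open>r\<close>, and, following parents from \<open>r\<close>, a chain vertex \<open>w\<close>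
  from which \<open>cnf\<close> is reached without passing through \<open>ret\<close>.  But \<open>z\<close> and \<open>cnf\<close> both have second entry
  \<open>a\<close>.
\<close>

lemma forceable_return_to_chain:
  assumes pc: "proper V c" and ct: "c ` V \<subseteq> {..<t}" and "z \<in> V" "a \<noteq> b" "c z \<noteq> a" "c z \<noteq> b"
    and ret: "ret \<in> V" "c ret = a" "E z ret" and cnf: "cnf \<in> V" "c cnf = b" "E z cnf"
    and r: "r \<in> V" "c r = a" "E z r"
    and rc: "conn (kempe V c a b) ret cnf"
    and w: "conn (kempe V c a b - {ret}) w cnf"
    and par: "\<And>v. v \<in> V - {z} - {v. conn (kempe V c a b) ret v} \<Longrightarrow> par v \<in> V \<and> E v (par v)"
    and par_reach: "\<And>v S. v \<in> V - {z} \<Longrightarrow> v \<in> S \<Longrightarrow>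
      (\<forall>u \<in> S \<inter> (V - {z} - {v. conn (kempe V c a b) ret v}). par u \<in> S) \<Longrightarrow>
      \<exists>k. conn (kempe V c a b) ret k \<and> k \<in> S"
    and r_reach: "\<And>S. r \<in> S \<Longrightarrow>
      (\<forall>u \<in> S \<inter> (V - {z} - {v. conn (kempe V c a b) ret v}). par u \<in> S) \<Longrightarrow> w \<in> S"
  shows "forceable t V"
proof -
  let ?W = "kempe V c a b"
  let ?K = "{v. conn ?W ret v}"
  have "ret \<in> ?W" "cnf \<in> ?W" using ret cnf by (auto simp: kempe_def)
  then have KW: "v \<in> ?W" if "conn ?W ret v" for v using that conn_mem by blast
  have zW: "z \<notin> ?W" using assms by (auto simp: kempe_def)
  have neq: "z \<noteq> ret" "z \<noteq> cnf" "ret \<noteq> cnf" using zW \<open>ret \<in> ?W\<close> \<open>cnf \<in> ?W\<close> ret cnf assms by auto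
  define d where "d = (\<lambda>v. if v = z then a else if v = ret then c z
     else if conn ?W ret v then exchange a b (c v) else c (par v))"
  have lt: "a < t" "b < t" "c z < t"
    using ct ret cnf \<open>z \<in> V\<close> by auto
  have "forced V c d"
  proof (rule forcedI[OF pc])
    show "d v \<noteq> c v" if "v \<in> V" for v
    proof -
      have "c (par v) \<noteq> c v" if "v \<noteq> z" "\<not> conn ?W ret v"
        using par[of v] that \<open>v \<in> V\<close> properD[OF pc, of v "par v"] by auto
      moreover have "exchange a b (c v) \<noteq> c v" if "conn ?W ret v"
        using KW[OF that] \<open>a \<noteq> b\<close> by (auto simp: kempe_def exchange_def)
      ultimately show ?thesis
        using assms by (auto simp: d_def)
    qed
  next
    fix S s
    assume S: "S \<subseteq> V" "s \<in> S"
      and cl: "\<And>u v. u \<in> S \<Longrightarrow> v \<in> V \<Longrightarrow> E u v \<Longrightarrow> c v = d u \<Longrightarrow> v \<in> S"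
      and cf: "\<And>u v. u \<in> S \<Longrightarrow> v \<in> S \<Longrightarrow> E u v \<Longrightarrow> d u \<noteq> d v"
    have parS: "\<forall>u \<in> S \<inter> (V - {z} - ?K). par u \<in> S"
    proof
      fix u assume u: "u \<in> S \<inter> (V - {z} - ?K)"
      then have "d u = c (par u)" using conn_refl by (auto simp: d_def)
      then show "par u \<in> S" using cl[of u "par u"] par[of u] u by auto
    qed
    have Kstep: "v \<in> S" if "u \<in> S" "conn ?W ret u" "u \<noteq> ret" "v \<in> ?W" "E u v" for u v
    proof (rule cl[OF \<open>u \<in> S\<close> _ \<open>E u v\<close>])
      show "v \<in> V" using that by (auto simp: kempe_def)
      have "u \<in> ?W" using KW that by auto
      then have "u \<noteq> z" "c u \<noteq> c v"
        using zW that properD[OF pc, of u v] by (auto simp: kempe_def)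
      then show "c v = d u"
        using \<open>u \<in> ?W\<close> that by (auto simp: d_def exchange_def kempe_def)
    qed
    have ret_in: "ret \<in> S" if "conn ?W ret k" "k \<in> S" for k
    proof -
      have "conn ?W k ret" using that conn_sym by blast
      then have "k \<in> S \<longrightarrow> conn ?W ret k \<longrightarrow> ret \<in> S"
      proof (induction rule: conn_converse_induct)
        case (step y v)
        then show ?case
          using Kstep[of y v] conn_trans[OF _ conn_edge, of ?W ret y v] by blast
      qed simp
      with that show ?thesis by simp
    qed
    have "z \<in> S \<or> (\<exists>k. conn ?W ret k \<and> k \<in> S)"
      using par_reach[of s S] S parS by auto
    then have "z \<in> S"
      using ret_in cl[of ret z] adj_sym[OF ret(3)] \<open>z \<in> V\<close> neq by (auto simp: d_def)
    then have "r \<in> S" using cl[of z r] r by (auto simp: d_def)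
    then have "w \<in> S" using r_reach parS by blast
    have wc: "conn ?W ret w"
      using rc conn_sym[OF conn_mono[OF w, of ?W]] conn_trans by blast
    have "cnf \<in> S \<inter> ?K"
      using w
    proof (rule conn_closed)
      show "w \<in> S \<inter> ?K" using \<open>w \<in> S\<close> wc by simp
      show "v \<in> S \<inter> ?K" if "u \<in> S \<inter> ?K" "u \<in> ?W - {ret}" "v \<in> ?W - {ret}" "E u v" for u v
        using that Kstep[of u v] conn_trans[OF _ conn_edge, of ?W ret u v] by blast
    qed
    then have "cnf \<in> S" by simp
    moreover have "d cnf = a" "d z = a"
      using neq rc cnf \<open>a \<noteq> b\<close> by (auto simp: d_def exchange_def)
    ultimately show False using cf[OF \<open>z \<in> S\<close>, of cnf] cnf by simp
  qed
  moreover have "d v < t" if "v \<in> V" for v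
  proof -
    have "c (par v) < t" if "v \<noteq> z" "\<not> conn ?W ret v"
      using par[of v] that \<open>v \<in> V\<close> ct by auto
    moreover have "c v < t" using ct that by auto
    ultimately show ?thesis using lt by (auto simp: d_def exchange_def)
  qed
  ultimately show ?thesis unfolding forceable_def using ct by blast
qed

text \<open>
  If \<open>r\<close> lies in the chain of \<open>x\<close> and \<open>y\<close>, a walk from \<open>y\<close> in the chain reaches one of \<open>r\<close> and \<open>x\<close>
  first, and the other one serves as \<open>ret\<close>.  Otherwise a path leads from \<open>r\<close> to some chain vertex \<open>w\<close> without using \<open>z\<close>; from
  there one of \<open>x\<close> and \<open>y\<close> is reached first, and the other one serves as \<open>ret\<close>.  The pattern needs
  \<open>r\<close> to have the colour of \<open>ret\<close>; when that is \<open>y\<close>, the chain of \<open>r\<close> is exchanged, which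
  leaves the chain of \<open>x\<close> and \<open>y\<close> unchanged.
\<close>

lemma forceable_two_like_nbrs:
  assumes pc: "proper V c" and ct: "c ` V \<subseteq> {..<t}" and "z \<in> V" "a \<noteq> b" "c z \<noteq> a" "c z \<noteq> b"
    and x: "x \<in> V" "c x = a" "E z x" and y: "y \<in> V" "c y = b" "E z y"
    and r: "r \<in> V" "c r = a" "E z r" "r \<noteq> x"
    and xy: "conn (kempe V c a b) x y"
    and con: "\<And>u v. u \<in> V - {z} \<Longrightarrow> v \<in> V - {z} \<Longrightarrow> conn (V - {z}) u v"
  shows "forceable t V"
proof -
  let ?W = "kempe V c a b"
  let ?K = "{v. conn ?W x v}"
  have zW: "z \<notin> ?W" and xW: "x \<in> ?W" and yW: "y \<in> ?W"
    using assms by (auto simp: kempe_def)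
  have xz: "x \<in> V - {z}" using xW zW x by auto
  have ry: "r \<noteq> y" "x \<noteq> y" using assms by auto
  obtain par where par0: "\<And>v. v \<in> V - {z} - ?K \<Longrightarrow> par v \<in> V - {z} \<and> E v (par v)"
    and reach0: "\<And>v. v \<in> V - {z} \<Longrightarrow>
      \<exists>w\<in>?K. \<forall>S. v \<in> S \<longrightarrow> (\<forall>u \<in> S \<inter> (V - {z} - ?K). par u \<in> S) \<longrightarrow> w \<in> S"
    by (rule parents[of "V - {z}" ?K]) (use con xz in \<open>auto intro!: exI[of _ x]\<close>)
  have par: "\<And>v. v \<in> V - {z} - ?K \<Longrightarrow> par v \<in> V \<and> E v (par v)"
    using par0 by blast
  have reach: "\<And>v S. v \<in> V - {z} \<Longrightarrow> v \<in> S \<Longrightarrow> (\<forall>u \<in> S \<inter> (V - {z} - ?K). par u \<in> S) \<Longrightarrow>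
      \<exists>k. conn ?W x k \<and> k \<in> S"
    using reach0 by blast
  have same: "{v. conn ?W u v} = ?K" if "conn ?W x u" for u
    using that conn_trans conn_sym by blast
  show ?thesis
  proof (cases "conn ?W x r")
    case True
    have Kr: "conn ?W r v \<longleftrightarrow> conn ?W x v" for v
      using same[OF True] by blast
    have "conn ?W y x" using conn_sym xy by blast
    then have "conn (?W - {r}) y x \<or> conn (?W - {x}) y r"
      using conn_first_hit[of ?W y x r] r by auto
    then show ?thesis
    proof
      assume h: "conn (?W - {r}) y x"
      show ?thesis
        by (rule forceable_return_to_chain[OF pc ct assms(3-6) r(1,2,3) y x, where w = x and par = par])
          (use h Kr xy conn_sym par reach in auto)
    next
      assume h: "conn (?W - {x}) y r"
      show ?thesis
        by (rule forceable_return_to_chain[OF pc ct assms(3-6) x y r(1-3), where w = r and par = par])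
          (use h xy conn_sym par reach in auto)
    qed
  next
    case False
    have rz: "r \<in> V - {z}" using assms by auto
    obtain w where w: "conn ?W x w"
      and wS: "\<And>S. r \<in> S \<Longrightarrow> (\<forall>u \<in> S \<inter> (V - {z} - ?K). par u \<in> S) \<Longrightarrow> w \<in> S"
      using reach0[OF rz] by blast
    have "conn (?W - {y}) w x \<or> conn (?W - {x}) w y"
      using conn_first_hit[of ?W w x y] conn_sym[OF w] ry by auto
    then show ?thesis
    proof
      assume h: "conn (?W - {x}) w y"
      show ?thesis
        by (rule forceable_return_to_chain[OF pc ct assms(3-6) x y r(1-3), where w = w and par = par])
          (use h xy par reach wS in auto)
    next
      assume h: "conn (?W - {y}) w x"
      define Q where "Q = {v. conn ?W r v}"
      define c' where "c' = (\<lambda>v. if v \<in> Q then exchange a b (c v) else c v)"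
      have rW: "r \<in> ?W" using r by (auto simp: kempe_def)
      have QW: "v \<in> ?W" if "v \<in> Q" for v
        using that rW conn_mem by (auto simp: Q_def)
      have pc': "proper V c'"
        unfolding c'_def
      proof (rule proper_kempe[OF pc])
        show "v \<in> Q" if "u \<in> Q" "v \<in> V" "E u v" "c v = a \<or> c v = b" for u v
        proof -
          have "v \<in> ?W" using that by (auto simp: kempe_def)
          then show ?thesis
            using QW that conn_trans[OF _ conn_edge, of ?W r u v] by (auto simp: Q_def)
        qed
        show "c u = a \<or> c u = b" if "u \<in> Q" for u
          using QW[OF that] by (auto simp: kempe_def)
      qed
      have lt: "a < t" "b < t" using ct x y by auto
      have ct': "c' ` V \<subseteq> {..<t}"
        using ct lt by (auto simp: c'_def exchange_def)
      have W': "kempe V c' b a = ?W"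
        using \<open>a \<noteq> b\<close> by (auto simp: kempe_def c'_def exchange_def split: if_splits)
      have notQ: "x \<notin> Q" "y \<notin> Q" "z \<notin> Q"
        using False xy zW QW conn_sym conn_trans unfolding Q_def by blast+
      have col: "c' z = c z" "c' x = a" "c' y = b" "c' r = b"
        using notQ x y r by (auto simp: c'_def Q_def exchange_def)
      have Ky: "conn ?W y v \<longleftrightarrow> conn ?W x v" for v
        using same[OF xy] by blast
      show ?thesis
        by (rule forceable_return_to_chain[OF pc' ct' \<open>z \<in> V\<close>, where a = b and b = a and ret = y and cnf = x
              and r = r and w = w and par = par])
          (use assms col h conn_sym par reach wS in \<open>auto simp: W' Ky\<close>)
    qed
  qed
qed

end

section \<open>Colourings with a smallest colour class\<close>

locale unforceable = adjacency E for E :: "'a \<Rightarrow> 'a \<Rightarrow> bool" +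
  fixes V :: "'a set" and t :: nat
  assumes finite_V: "finite V"
    and t_ge_3: "3 \<le> t"
    and colourable: "\<exists>c. proper V c \<and> c ` V \<subseteq> {..<t}"
    and not_fewer: "\<not> (\<exists>c. proper V c \<and> c ` V \<subseteq> {..<t - 1})"
    and connected: "u \<in> V \<Longrightarrow> v \<in> V \<Longrightarrow> conn V u v"
    and no_cut: "z \<in> V \<Longrightarrow> u \<in> V - {z} \<Longrightarrow> v \<in> V - {z} \<Longrightarrow> conn (V - {z}) u v"
    and not_forceable: "\<not> forceable t V"
begin

definition top_class :: "('a \<Rightarrow> nat) \<Rightarrow> 'a set" where
  "top_class c = {v \<in> V. c v = t - 1}"

definition smallest :: "('a \<Rightarrow> nat) \<Rightarrow> bool" where
  "smallest c \<longleftrightarrow> proper V c \<and> c ` V \<subseteq> {..<t} \<and>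
     (\<forall>c'. proper V c' \<longrightarrow> c' ` V \<subseteq> {..<t} \<longrightarrow> card (top_class c) \<le> card (top_class c'))"

text \<open>
  The last colour on \<open>z\<close> is thought of as a token, because recolouring will move it from vertex to vertex
  while the colouring stays \<open>smallest\<close>.
\<close>

definition token :: "('a \<Rightarrow> nat) \<Rightarrow> 'a \<Rightarrow> bool" where
  "token c z \<longleftrightarrow> smallest c \<and> z \<in> V \<and> c z = t - 1"

lemma tokenD:
  assumes "token c z"
  shows "proper V c" "c ` V \<subseteq> {..<t}" "z \<in> V" "c z = t - 1"
  using assms by (auto simp: token_def smallest_def)

lemma token_exists: "\<exists>c z. token c z"
proof -
  obtain c0 where c0: "proper V c0 \<and> c0 ` V \<subseteq> {..<t}" using colourable by blast
  obtain c where c: "proper V c \<and> c ` V \<subseteq> {..<t}"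
    and min: "\<And>c'. proper V c' \<and> c' ` V \<subseteq> {..<t} \<Longrightarrow> card (top_class c) \<le> card (top_class c')"
    using ex_has_least_nat[of "\<lambda>c. proper V c \<and> c ` V \<subseteq> {..<t}" c0 "\<lambda>c. card (top_class c)"] c0
    by blast
  have "\<not> c ` V \<subseteq> {..<t - 1}" using not_fewer c by blast
  then obtain z where "z \<in> V" "\<not> c z < t - 1" by auto
  moreover have "c z < t" using c \<open>z \<in> V\<close> by auto
  ultimately have "token c z" using c min by (auto simp: token_def smallest_def)
  then show ?thesis by blast
qed

lemma nbr_colour:
  assumes "token c z" "x \<in> V" "E z x"
  shows "c x < t - 1"
proof -
  have "c x \<noteq> t - 1" using properD[of V c z x] tokenD[OF assms(1)] assms(2,3) by simp
  moreover have "c x < t" using tokenD[OF assms(1)] assms(2) by auto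
  ultimately show ?thesis by simp
qed

text \<open>
  Otherwise, exchange \<open>a\<close> and \<open>b\<close> in all chains that contain a neighbour of \<open>z\<close> coloured \<open>a\<close>.  No
  neighbour of \<open>z\<close> is then coloured \<open>a\<close>, so \<open>z\<close> can take that colour, and the last class shrinks.
\<close>

lemma linked:
  assumes tok: "token c z" and ab: "a < t - 1" "b < t - 1" "a \<noteq> b"
  shows "\<exists>x y. x \<in> V \<and> E z x \<and> c x = a \<and> y \<in> V \<and> E z y \<and> c y = b \<and> conn (kempe V c a b) x y"
proof (rule ccontr)
  assume neg: "\<not> ?thesis"
  note D = tokenD[OF tok]
  let ?W = "kempe V c a b"
  define Q where "Q = {v. \<exists>x\<in>V. E z x \<and> c x = a \<and> conn ?W x v}"
  have QW: "v \<in> ?W" if "v \<in> Q" for v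
  proof -
    obtain x where x: "x \<in> V" "c x = a" "conn ?W x v" using \<open>v \<in> Q\<close> by (auto simp: Q_def)
    then have "x \<in> ?W" by (simp add: kempe_def)
    then show ?thesis using x conn_mem by blast
  qed
  define c1 where "c1 = (\<lambda>v. if v \<in> Q then exchange a b (c v) else c v)"
  have p1: "proper V c1"
    unfolding c1_def
  proof (rule proper_kempe[OF D(1)])
    show "v \<in> Q" if uv: "u \<in> Q" "v \<in> V" "E u v" "c v = a \<or> c v = b" for u v
    proof -
      obtain x where x: "x \<in> V" "E z x" "c x = a" "conn ?W x u" using uv(1) by (auto simp: Q_def)
      have "conn ?W u v" using QW[OF uv(1)] uv by (intro conn_edge) (auto simp: kempe_def)
      with x show ?thesis using conn_trans unfolding Q_def by blast
    qed
    show "c u = a \<or> c u = b" if "u \<in> Q" for u using QW[OF that] by (auto simp: kempe_def)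
  qed
  have no_a: "c1 v \<noteq> a" if "v \<in> V" "E z v" for v
  proof (cases "v \<in> Q")
    case True
    then have "c v \<noteq> b" using neg that unfolding Q_def by blast
    with True QW[OF True] ab show ?thesis by (auto simp: c1_def kempe_def exchange_def)
  next
    case False
    then have "c v \<noteq> a" using that conn_refl unfolding Q_def by blast
    with False show ?thesis by (simp add: c1_def)
  qed
  define c2 where "c2 = c1(z := a)"
  have "proper V c2"
    unfolding proper_def
  proof (intro ballI impI)
    fix u v assume uv: "u \<in> V" "v \<in> V" "E u v"
    then show "c2 u \<noteq> c2 v"
      using properD[OF p1 uv] no_a[of u] no_a[of v] adj_sym[of u v] adj_irrefl
      by (auto simp: c2_def)
  qed
  moreover have "c2 ` V \<subseteq> {..<t}"
    using D(2) ab by (auto simp: c2_def c1_def exchange_def)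
  ultimately have "card (top_class c) \<le> card (top_class c2)"
    using tok by (simp add: token_def smallest_def)
  moreover have "top_class c2 = top_class c - {z}"
    using ab QW by (auto simp: top_class_def c2_def c1_def exchange_def kempe_def)
  moreover have "z \<in> top_class c" "finite (top_class c)"
    using D finite_V by (auto simp: top_class_def)
  moreover from this have "0 < card (top_class c)" by (auto simp: card_gt_0_iff)
  ultimately show False by simp
qed

lemma unique_nbr:
  assumes tok: "token c z" and x: "x \<in> V" "E z x" and r: "r \<in> V" "E z r" and eq: "c r = c x"
  shows "r = x"
proof -
  have xc: "c x < t - 1" by (rule nbr_colour[OF tok x])
  define b where "b = (if c x = 0 then 1 else 0 :: nat)"
  have b: "b < t - 1" "b \<noteq> c x" using t_ge_3 by (auto simp: b_def)
  obtain x' y where xy: "x' \<in> V" "E z x'" "c x' = c x" "y \<in> V" "E z y" "c y = b"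
    "conn (kempe V c (c x) b) x' y"
    using linked[OF tok xc b(1)] b(2) by blast
  have "s = x'" if "s \<in> V" "E z s" "c s = c x" for s
  proof (rule ccontr)
    assume "s \<noteq> x'"
    have "forceable t V"
      by (rule forceable_two_like_nbrs[of V c t z "c x" b x' y s])
        (use tokenD[OF tok] xc b xy that \<open>s \<noteq> x'\<close> no_cut in auto)
    with not_forceable show False ..
  qed
  then show ?thesis using assms by metis
qed

lemma nbr_exists:
  assumes tok: "token c z" and a: "a < t - 1"
  shows "\<exists>x\<in>V. E z x \<and> c x = a"
proof -
  define b where "b = (if a = 0 then 1 else 0 :: nat)"
  have "b < t - 1" "a \<noteq> b" using t_ge_3 by (auto simp: b_def)
  then show ?thesis using linked[OF tok a] by blast
qed

text \<open>
  Give \<open>x\<close> the last colour and all its neighbours in the last class the old colour of \<open>x\<close>.  This is proper,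
  because \<open>x\<close> is the only neighbour of that colour for each of them.  As the last class does not become
  smaller, \<open>z\<close> was its only member next to \<open>x\<close>, and the result is a plain exchange of two colours.
\<close>

lemma token_move:
  assumes tok: "token c z" and x: "x \<in> V" "E z x"
  shows "token (c(z := c x, x := t - 1)) x"
proof -
  note D = tokenD[OF tok]
  have xc: "c x < t - 1" by (rule nbr_colour[OF tok x])
  define N where "N = {u \<in> V. c u = t - 1 \<and> E x u}"
  define c' where "c' = (\<lambda>v. if v = x then t - 1 else if v \<in> N then c x else c v)"
  have tokN: "token c u" if "u \<in> N" for u
    using that tok by (auto simp: N_def token_def)
  have NV: "N \<subseteq> V" by (auto simp: N_def)
  have zN: "z \<in> N" using D x adj_sym by (auto simp: N_def)
  have xN: "x \<notin> N" using xc by (auto simp: N_def)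
  have key: "c' u \<noteq> c' v" if "u \<in> V" "v \<in> V" "E u v" "u = x \<or> u \<in> N" for u v
  proof -
    have ne: "c u \<noteq> c v" using properD[OF D(1)] that by blast
    show ?thesis
    proof (cases "u = x")
      case True
      with that(3) have "v \<noteq> x" using adj_irrefl by auto
      then show ?thesis
        using True that xc by (auto simp: c'_def N_def)
    next
      case False
      then have "u \<in> N" using that by simp
      then have cu: "c u = t - 1" "E u x" using adj_sym by (auto simp: N_def)
      show ?thesis
      proof (cases "v = x")
        case True
        then show ?thesis using \<open>u \<in> N\<close> False xc by (simp add: c'_def)
      next
        case vx: False
        then have "c v \<noteq> c x" using unique_nbr[OF tokN[OF \<open>u \<in> N\<close>] x(1) cu(2), of v] that by auto
        moreover have "v \<notin> N" using ne cu by (auto simp: N_def)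
        moreover have "c' u = c x" using False \<open>u \<in> N\<close> by (simp add: c'_def)
        ultimately show ?thesis using vx by (simp add: c'_def)
      qed
    qed
  qed
  have pc': "proper V c'"
    unfolding proper_def
  proof (intro ballI impI)
    fix u v assume uv: "u \<in> V" "v \<in> V" "E u v"
    show "c' u \<noteq> c' v"
      using key[OF uv] key[OF uv(2,1) adj_sym[OF uv(3)]] properD[OF D(1) uv]
      by (cases "u = x \<or> u \<in> N"; cases "v = x \<or> v \<in> N") (metis, metis, metis, simp add: c'_def)
  qed
  have ct': "c' ` V \<subseteq> {..<t}" using D(2) xc by (auto simp: c'_def)
  have fin: "finite (top_class c)" "finite N"
    using finite_V by (auto simp: top_class_def N_def)
  have top': "top_class c' = insert x (top_class c - N)"
    using xc x xN by (auto simp: top_class_def c'_def)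
  have "N \<subseteq> top_class c" by (auto simp: N_def top_class_def)
  then have "card (top_class c - N) = card (top_class c) - card N"
    by (rule card_Diff_subset[OF fin(2)])
  moreover have "card N \<le> card (top_class c)"
    by (rule card_mono[OF fin(1) \<open>N \<subseteq> top_class c\<close>])
  moreover have "x \<notin> top_class c" using xc by (simp add: top_class_def)
  ultimately have card': "card (top_class c') + card N = card (top_class c) + 1"
    using fin top' by simp
  have le: "card (top_class c) \<le> card (top_class c')"
    using tok pc' ct' by (simp add: token_def smallest_def)
  then have "card N \<le> 1" using card' by simp
  then have N1: "N = {z}"
    using zN fin card_le_Suc0_iff_eq[of N] by auto
  then have "card (top_class c') = card (top_class c)" using card' by simp
  then have "smallest c'"
    using pc' ct' tok by (auto simp: smallest_def token_def)
  moreover have "c' = c(z := c x, x := t - 1)"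
    using N1 by (auto simp: c'_def)
  ultimately show ?thesis using x by (simp add: token_def)
qed

lemma token_walk:
  assumes "conn X u v" "token c u" "X \<subseteq> V"
  shows "\<exists>c'. token c' v \<and> (\<forall>w. w \<notin> X \<longrightarrow> c' w = c w)"
  using assms(1)
proof (induction rule: conn_induct)
  case (step y w)
  then obtain c' where c': "token c' y" "\<And>v. v \<notin> X \<Longrightarrow> c' v = c v" by blast
  define c2 where "c2 = c'(y := c' w, w := t - 1)"
  have "token c2 w"
    unfolding c2_def by (rule token_move[OF c'(1)]) (use step assms in auto)
  moreover have "\<forall>v. v \<notin> X \<longrightarrow> c2 v = c v" using c'(2) step by (auto simp: c2_def)
  ultimately show ?case by blast
qed (use assms in blast)

lemma token_everywhere: "v \<in> V \<Longrightarrow> \<exists>c. token c v"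
proof -
  assume v: "v \<in> V"
  obtain c z where tok: "token c z" using token_exists by blast
  then have "conn V z v" using v connected tokenD by blast
  with token_walk[OF _ tok] show ?thesis by blast
qed

text \<open>
  Moving the token from \<open>z\<close> through \<open>x\<close> to \<open>y\<close> leaves the colour of \<open>y\<close> on \<open>x\<close>, which is also the colour
  of \<open>x'\<close>.  If the token could return to \<open>z\<close> without touching \<open>x\<close> and \<open>x'\<close>, then \<open>z\<close> would have
  two neighbours of one colour.
\<close>

lemma separated:
  assumes tok: "token c z" and x: "x \<in> V" "E z x" and x': "x' \<in> V" "E z x'" "x' \<noteq> x"
    and y: "y \<in> V" "E x y" "c y = c x'" "y \<noteq> x'"
  shows "\<not> conn (V - {x, x'}) y z"
proof
  assume path: "conn (V - {x, x'}) y z"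
  have c': "c x' < t - 1" by (rule nbr_colour[OF tok x'(1,2)])
  have yz: "y \<noteq> z" using y c' tokenD[OF tok] by auto
  have "y \<noteq> x" using y adj_irrefl by auto
  have zx: "z \<noteq> x" "z \<noteq> x'" using x x' adj_irrefl by auto
  define c1 where "c1 = c(z := c x, x := t - 1)"
  have t1: "token c1 x" unfolding c1_def by (rule token_move[OF tok x])
  define c2 where "c2 = c1(x := c1 y, y := t - 1)"
  have t2: "token c2 y" unfolding c2_def by (rule token_move[OF t1 y(1,2)])
  have c2: "c2 x = c x'" "c2 x' = c x'"
    using yz \<open>y \<noteq> x\<close> zx y x' by (auto simp: c2_def c1_def)
  obtain c3 where c3: "token c3 z" "\<And>w. w \<notin> V - {x, x'} \<Longrightarrow> c3 w = c2 w"
    using token_walk[OF path t2] by auto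
  then have "c3 x' = c3 x" using c2 by simp
  then show False using unique_nbr[OF c3(1) x x'(1,2)] x'(3) by simp
qed

text \<open>
  Suppose the neighbours \<open>x\<close> and \<open>x'\<close> of \<open>z\<close>, with colours \<open>a\<close> and \<open>b\<close>, are not adjacent, and let \<open>g\<close> be a
  third colour, worn by the neighbour \<open>xg\<close> of \<open>z\<close>.  With the token on \<open>x'\<close>, its neighbours \<open>y\<close> and \<open>v\<close>
  with colours \<open>a\<close> and \<open>g\<close> are joined by a chain.  By \<open>separated\<close>, deleting \<open>x\<close> and \<open>x'\<close> cuts \<open>y\<close> off
  from \<open>z\<close>.  If the chain avoids \<open>x\<close>, then \<open>v\<close> lies on the side of \<open>y\<close>, and as \<open>x'\<close> is no cut vertex,
  that side is joined to \<open>z\<close> through \<open>x\<close>, against \<open>separated\<close> for \<open>x'\<close>, \<open>xg\<close> and \<open>v\<close>.  If the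
  chain meets \<open>x\<close>, its last vertex \<open>u\<close> before \<open>x\<close> lies on the side of \<open>y\<close> and is joined to \<open>z\<close> through
  \<open>y\<close> and \<open>x'\<close>, against \<open>separated\<close> for \<open>x\<close>, \<open>xg\<close> and \<open>u\<close>.
\<close>

lemma nbrs_adjacent:
  assumes t4: "4 \<le> t" and tok: "token c z"
    and x: "x \<in> V" "E z x" and x': "x' \<in> V" "E z x'" "x' \<noteq> x"
  shows "E x x'"
proof (rule ccontr)
  assume nE: "\<not> E x x'"
  note D = tokenD[OF tok]
  define a where "a = c x"
  define b where "b = c x'"
  have ab: "a < t - 1" "b < t - 1" "a \<noteq> b"
    using nbr_colour[OF tok] x x' unique_nbr[OF tok x x'(1,2)] by (auto simp: a_def b_def)
  have "\<exists>g\<in>{0,1,2::nat}. g \<noteq> a \<and> g \<noteq> b"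
    by (cases "a = 0"; cases "b = 0"; cases "a = 1"; cases "b = 1") auto
  then obtain g where g012: "g \<in> {0, 1, 2::nat}" and g_ab: "g \<noteq> a" "g \<noteq> b" by blast
  have g: "g < t - 1" "g \<noteq> a" "g \<noteq> b" using g012 g_ab t4 by auto
  have zx: "z \<noteq> x" "z \<noteq> x'" using x x' adj_irrefl by auto
  obtain xg where xg: "xg \<in> V" "E z xg" "c xg = g" using nbr_exists[OF tok g(1)] by blast
  have xgn: "xg \<noteq> x" "xg \<noteq> x'" "xg \<noteq> z" using xg g adj_irrefl by (auto simp: a_def b_def)
  let ?W = "kempe V c a g"
  have Wn: "x' \<notin> ?W" "z \<notin> ?W" "?W \<subseteq> V"
    using ab g D by (auto simp: kempe_def b_def)
  define c1 where "c1 = c(z := b, x' := t - 1)"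
  have t1: "token c1 x'" unfolding c1_def b_def by (rule token_move[OF tok x'(1,2)])
  have W1: "kempe V c1 a g = ?W"
    using ab g D by (auto simp: kempe_def c1_def b_def)
  obtain y v where y: "y \<in> V" "E x' y" "c1 y = a" and v: "v \<in> V" "E x' v" "c1 v = g"
    and link: "conn ?W y v"
    using linked[OF t1 ab(1) g(1)] g(2) W1 by auto
  have cy: "c y = a" and cv: "c v = g"
    using y(3) v(3) ab g by (auto simp: c1_def split: if_splits)
  have yW: "y \<in> ?W" using y cy by (simp add: kempe_def)
  have yx: "y \<noteq> x" using y nE adj_sym by auto
  have vx: "v \<noteq> x" using cv g by (auto simp: a_def)
  have sep: "\<not> conn (V - {x, x'}) y z"
    using separated[OF tok x'(1,2) x _ y(1,2)] cy yx x'(3) by (auto simp: a_def insert_commute)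
  have no_xg: "\<not> conn (V - {x, x'}) y xg"
  proof
    assume "conn (V - {x, x'}) y xg"
    moreover have "conn (V - {x, x'}) xg z"
      using xg xgn zx D adj_sym by (intro conn_edge) auto
    ultimately show False using sep conn_trans by blast
  qed
  show False
  proof (cases "conn (?W - {x}) y v")
    case True
    then have yv: "conn (V - {x, x'}) y v" by (rule conn_mono) (use Wn in auto)
    then have "v \<noteq> xg" using no_xg by auto
    then have sep2: "\<not> conn (V - {x', xg}) v z"
      using separated[OF tok x'(1,2) xg(1,2) _ v(1,2)] xgn cv xg by simp
    have "v \<noteq> x'" using v adj_irrefl by auto
    then have "conn (V - {x'}) v z" using no_cut x' v D zx by simp
    then have "conn (V - {x'} - {xg}) v z \<or> conn (V - {x'} - {z}) v xg"
      using conn_first_hit xgn(3) by metis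
    moreover have "V - {x'} - {xg} = V - {x', xg}" by auto
    ultimately have "conn (V - {x'}) v xg"
      using sep2 conn_mono[of "V - {x'} - {z}" v xg "V - {x'}"] by auto
    then have "conn (V - {x'} - {x}) v xg \<or> conn (V - {x'} - {xg}) v x"
      using conn_first_hit xgn(1) by metis
    then show False
    proof
      assume "conn (V - {x'} - {x}) v xg"
      then have "conn (V - {x, x'}) v xg" by (rule conn_mono) auto
      then show False using yv no_xg conn_trans by blast
    next
      assume "conn (V - {x'} - {xg}) v x"
      then have "conn (V - {x', xg}) v x" by (rule conn_mono) auto
      moreover have "conn (V - {x', xg}) x z"
        using x xgn zx D x' adj_sym by (intro conn_edge) auto
      ultimately show False using sep2 conn_trans by blast
    qed
  next
    case False
    then have "conn (?W - {v}) y x"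
      using conn_first_hit[OF link vx] by blast
    then have "conn ?W y x" by (rule conn_mono) auto
    from conn_last_step[OF this yx] obtain u where
      u: "u \<in> ?W" "u \<noteq> x" "E u x" "conn (?W - {x}) y u" by blast
    have "c u \<noteq> c x" using properD[OF D(1), of u x] u x by (auto simp: kempe_def)
    then have cu: "c u = g" "u \<in> V" using u by (auto simp: kempe_def a_def)
    have yu: "conn (V - {x, x'}) y u" by (rule conn_mono[OF u(4)]) (use Wn in auto)
    then have "u \<noteq> xg" using no_xg by auto
    then have sep3: "\<not> conn (V - {x, xg}) u z"
      using separated[OF tok x xg(1,2) _ cu(2) adj_sym[OF u(3)]] xgn cu xg by simp
    have "y \<noteq> xg" using cy xg g by auto
    have "conn (V - {x, x'}) u y" using yu conn_sym by blast
    then have "conn (V - {x, x'} - {xg}) u y \<or> conn (V - {x, x'} - {y}) u xg"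
      using conn_first_hit \<open>y \<noteq> xg\<close> by metis
    then show False
    proof
      assume "conn (V - {x, x'} - {xg}) u y"
      then have "conn (V - {x, xg}) u y" by (rule conn_mono) auto
      also have "conn (V - {x, xg}) y x'"
        using y yx \<open>y \<noteq> xg\<close> x' xgn adj_sym by (intro conn_edge) auto
      also have "conn (V - {x, xg}) x' z"
        using x' xgn zx D adj_sym by (intro conn_edge) auto
      finally show False using sep3 by blast
    next
      assume "conn (V - {x, x'} - {y}) u xg"
      then have "conn (V - {x, x'}) u xg" by (rule conn_mono) auto
      then show False using yu no_xg conn_trans by blast
    qed
  qed
qed

text \<open>
  Adjacency is transitive on distinct vertices, because every vertex can carry the token.
\<close>

lemma complete:
  assumes "4 \<le> t" "u \<in> V" "v \<in> V" "u \<noteq> v"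
  shows "E u v"
proof -
  have "conn V u v" using assms connected by simp
  then have "v = u \<or> E u v"
  proof (induction rule: conn_induct)
    case (step y w)
    obtain c where "token c y" using token_everywhere step by blast
    then show ?case
      using nbrs_adjacent[OF assms(1), of c y u w] step assms(2) adj_sym by blast
  qed simp
  with assms show ?thesis by simp
qed

lemma two_regular:
  assumes "t = 3" "v \<in> V"
  shows "\<exists>u w. u \<noteq> w \<and> {x \<in> V. E v x} = {u, w}"
proof -
  obtain c where tok: "token c v" using token_everywhere assms by blast
  obtain u where u: "u \<in> V" "E v u" "c u = 0" using nbr_exists[OF tok, of 0] assms by auto
  obtain w where w: "w \<in> V" "E v w" "c w = 1" using nbr_exists[OF tok, of 1] assms by auto
  have "x = u \<or> x = w" if "x \<in> V" "E v x" for x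
  proof -
    have "c x < 2" using nbr_colour[OF tok that] assms by simp
    then have "c x = c u \<or> c x = c w" using u w by auto
    then show ?thesis using unique_nbr[OF tok] u w that by blast
  qed
  then have "{x \<in> V. E v x} = {u, w}" using u w by blast
  moreover have "u \<noteq> w" using u w by auto
  ultimately show ?thesis by blast
qed

lemma not_forced: "\<not> forced V c d"
proof -
  have "V \<noteq> {}" using token_exists tokenD by blast
  show ?thesis
  proof (cases "t = 3")
    case True
    then show ?thesis using two_regular two_regular_not_forced finite_V \<open>V \<noteq> {}\<close> by blast
  next
    case False
    then have "4 \<le> t" using t_ge_3 by simp
    show ?thesis
      by (rule complete_not_forced[OF finite_V \<open>V \<noteq> {}\<close>]) (rule complete[OF \<open>4 \<le> t\<close>])
  qed
qed

end

section \<open>Two-connected bipartite graphs\<close>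

locale bipartite_unforceable = adjacency E for E :: "'a \<Rightarrow> 'a \<Rightarrow> bool" +
  fixes V :: "'a set" and side :: "'a \<Rightarrow> bool"
  assumes finite_V: "finite V"
    and sides: "u \<in> V \<Longrightarrow> v \<in> V \<Longrightarrow> E u v \<Longrightarrow> side u \<noteq> side v"
    and connected: "u \<in> V \<Longrightarrow> v \<in> V \<Longrightarrow> conn V u v"
    and no_cut: "z \<in> V \<Longrightarrow> u \<in> V - {z} \<Longrightarrow> v \<in> V - {z} \<Longrightarrow> conn (V - {z}) u v"
    and not_forceable: "\<not> forceable 3 V"
begin

definition far :: "'a \<Rightarrow> 'a set" where
  "far p = {v \<in> V. v \<noteq> p \<and> \<not> E p v}"

text \<open>
  The forcing pattern behind the bipartite case.  The colours are 0 on \<open>p\<close> and its non-neighbours on the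
  opposite side, 1 on the neighbours of \<open>p\<close>, and 2 elsewhere.  Let \<open>Q\<close> be the component of \<open>q\<close> after
  deletion of \<open>p\<close>, its neighbours and \<open>y\<close>; it is a chain in the colours 0 and 2.  Second entries follow
  the chain in \<open>Q\<close>, point from \<open>y\<close> to the neighbours of \<open>p\<close>, from \<open>p\<close> to its neighbours and from these
  back to \<open>p\<close>, except that \<open>x\<close> points to \<open>Q\<close>.  Thus switching anything switches
  \<open>Q\<close>, \<open>y\<close>, \<open>x2\<close>, \<open>p\<close>, then \<open>x\<close> and again \<open>Q\<close>.  In the end \<open>x'\<close> and its neighbour \<open>y2\<close> in
  \<open>Q\<close> are both switched, although both have second entry 0.
\<close>

lemma star_not_attached_twice:
  assumes p: "p \<in> V" and y: "y \<in> V" "y \<noteq> p" "side y = side p"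
    and q: "q \<in> V" "E y q" "\<not> E p q"
    and x2: "x2 \<in> V" "E p x2" "E y x2"
    and x: "x \<in> V" "E p x" "x \<noteq> x2" and y1: "conn (far p - {y}) q y1" "E x y1"
    and x': "x' \<in> V" "E p x'" "x' \<noteq> x" and y2: "conn (far p - {y}) q y2" "E x' y2"
  shows False
proof -
  let ?X = "far p - {y}"
  let ?Q = "{v. conn ?X q v}"
  have "side q \<noteq> side p" "q \<noteq> y" using sides[OF y(1) q(1,2)] y q adj_irrefl by auto
  then have qX: "q \<in> ?X" using q by (auto simp: far_def)
  have QX: "v \<in> ?X" if "conn ?X q v" for v using conn_mem that qX by blast
  define c where "c = (\<lambda>v. if v = p then 0 else if E p v then 1
    else if side v = side p then 2 else 0 :: nat)"
  have sp: "side v \<noteq> side p" if "v \<in> V" "E p v" for v using sides[OF p that] by simp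
  have pc: "proper V c"
    unfolding proper_def
  proof (intro ballI impI)
    fix u v assume uv: "u \<in> V" "v \<in> V" "E u v"
    show "c u \<noteq> c v"
      using sides[OF uv] sp[of u] sp[of v] uv adj_sym[OF uv(3)] adj_irrefl by (auto simp: c_def)
  qed
  let ?T = "?Q \<union> {p, y} \<union> {v \<in> V. E p v}"
  have "\<exists>w\<in>?T. conn V v w" if "v \<in> V" for v
    using connected[OF that p] by blast
  then obtain par where par: "\<And>v. v \<in> V - ?T \<Longrightarrow> par v \<in> V \<and> E v (par v)"
    and reach: "\<And>v. v \<in> V \<Longrightarrow> \<exists>w\<in>?T. \<forall>S. v \<in> S \<longrightarrow> (\<forall>u \<in> S \<inter> (V - ?T). par u \<in> S) \<longrightarrow> w \<in> S"
    by (rule parents[of V ?T]) blast+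
  define d where "d = (\<lambda>v. if v = p then 1 else if v = x then 2 else if E p v then 0
    else if v = y then 1 else if conn ?X q v then exchange 0 2 (c v) else c (par v))"
  have py: "\<not> E p y" using sp[of y] y by auto
  have cols: "c p = 0" "c y = 2" "\<And>v. E p v \<Longrightarrow> c v = 1"
    using y py adj_irrefl by (auto simp: c_def)
  have cX: "c v = (if side v = side p then 2 else 0)" if "v \<in> ?X" for v
    using that by (auto simp: c_def far_def)
  have dQ: "d v = exchange 0 2 (c v)" if "conn ?X q v" for v
    using QX[OF that] that x by (auto simp: d_def far_def)
  have dN: "d v = 0" if "E p v" "v \<noteq> x" for v
    using that adj_irrefl by (auto simp: d_def)
  have dpxy: "d p = 1" "d x = 2" "d y = 1"
    using x y py adj_irrefl by (auto simp: d_def)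
  have dpar: "d v = c (par v)" if "v \<in> V - ?T" for v
    using that x by (auto simp: d_def)
  have y1X: "y1 \<in> ?X" "y1 \<in> V" "c y1 = 2" and y2X: "y2 \<in> ?X" "y2 \<in> V" "c y2 = 2"
  proof -
    show X: "y1 \<in> ?X" "y2 \<in> ?X" using QX y1 y2 by auto
    then show V: "y1 \<in> V" "y2 \<in> V" by (auto simp: far_def)
    show "c y1 = 2" "c y2 = 2"
      using cX[OF X(1)] cX[OF X(2)] sides[OF x(1) V(1) y1(2)] sides[OF x'(1) V(2) y2(2)]
        sp[OF x(1,2)] sp[OF x'(1,2)] by auto
  qed
  have "forced V c d"
  proof (rule forcedI[OF pc])
    show "d v \<noteq> c v" if "v \<in> V" for v
    proof (cases "v \<in> ?T")
      case True
      then consider "v = p" | "v = y" | "E p v" | "conn ?X q v" by auto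
      then show ?thesis
      proof cases
        case 3
        then show ?thesis using dN[of v] dpxy cols by (cases "v = x") auto
      next
        case 4
        then show ?thesis using dQ cX[OF QX[OF 4]] by (auto simp: exchange_def)
      qed (use dpxy cols in auto)
    next
      case False
      then show ?thesis using dpar[of v] par[of v] that properD[OF pc, of v "par v"] by auto
    qed
  next
    fix S s
    assume S: "S \<subseteq> V" "s \<in> S"
      and cl: "\<And>u v. u \<in> S \<Longrightarrow> v \<in> V \<Longrightarrow> E u v \<Longrightarrow> c v = d u \<Longrightarrow> v \<in> S"
      and cf: "\<And>u v. u \<in> S \<Longrightarrow> v \<in> S \<Longrightarrow> E u v \<Longrightarrow> d u \<noteq> d v"
    have "\<forall>u \<in> S \<inter> (V - ?T). par u \<in> S"
    proof
      fix u assume u: "u \<in> S \<inter> (V - ?T)"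
      then show "par u \<in> S" using cl[of u "par u"] par[of u] dpar[of u] by auto
    qed
    moreover have "s \<in> V" using S by auto
    ultimately obtain k where k: "k \<in> ?T" "k \<in> S" using reach[of s] S(2) by blast
    have Qstep: "v \<in> S" if "u \<in> S" "conn ?X q u" "v \<in> ?X" "E u v" for u v
    proof (rule cl[OF that(1) _ that(4)])
      have V: "u \<in> V" "v \<in> V" using QX[OF that(2)] that(3) by (auto simp: far_def)
      then show "v \<in> V" by simp
      show "c v = d u"
        using sides[OF V that(4)]
        by (cases "side u = side p")
          (simp_all add: dQ[OF that(2)] cX[OF that(3)] cX[OF QX[OF that(2)]] exchange_def)
    qed
    have Qall: "v \<in> S" if "conn ?X q u" "u \<in> S" "conn ?X u v" for u v
    proof -
      have "v \<in> {v \<in> S. conn ?X q v}"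
        using that(3)
      proof (rule conn_closed)
        show "u \<in> {v \<in> S. conn ?X q v}" using that by simp
        show "w \<in> {v \<in> S. conn ?X q v}"
          if "v \<in> {v \<in> S. conn ?X q v}" "v \<in> ?X" "w \<in> ?X" "E v w" for v w
          using that Qstep[of v w] conn_trans[OF _ conn_edge, of ?X q v w] by blast
      qed
      then show ?thesis by simp
    qed
    have y_p: "p \<in> S" if "y \<in> S"
    proof -
      have "x2 \<in> S" using cl[OF that x2(1,3)] cols(3)[OF x2(2)] dpxy by simp
      then show ?thesis using cl[of x2 p] p x2 x dN[of x2] cols adj_sym by auto
    qed
    have Q_p: "p \<in> S" if "conn ?X q u" "u \<in> S" for u
    proof -
      have "q \<in> S" using Qall[OF that] conn_sym that by blast
      then have "y \<in> S"
        using cl[of q y] y q adj_sym dQ[of q] cX[OF qX] cols \<open>side q \<noteq> side p\<close>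
        by (auto simp: exchange_def)
      then show ?thesis by (rule y_p)
    qed
    have x_y1: "y1 \<in> S" if "x \<in> S"
      using cl[OF that y1X(2) y1(2)] y1X dpxy by simp
    have "p \<in> S"
    proof (cases "E p k")
      case True
      show ?thesis
      proof (cases "k = x")
        case True
        then show ?thesis using x_y1 k(2) Q_p[OF y1(1)] by simp
      next
        case False
        then show ?thesis
          using cl[OF k(2) p adj_sym[OF True]] dN[OF True] cols(1) by simp
      qed
    next
      case False
      then show ?thesis using k y_p Q_p by blast
    qed
    then have NS: "v \<in> S" if "v \<in> V" "E p v" for v
      using cl[of p v] that cols dpxy by auto
    have "y1 \<in> S" using x_y1 NS x by blast
    moreover have "conn ?X y1 y2" using conn_trans[OF conn_sym[OF y1(1)] y2(1)] .
    ultimately have "y2 \<in> S" using Qall y1(1) by blast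
    moreover have "d x' = 0" "d y2 = 0"
      using dN x' dQ[OF y2(1)] y2X by (auto simp: exchange_def)
    ultimately show False using cf[OF NS[OF x'(1,2)], of y2] y2 by simp
  qed
  moreover have "c v < 3" for v by (auto simp: c_def)
  moreover from this have "d v < 3" for v by (auto simp: d_def exchange_def)
  ultimately show False using not_forceable unfolding forceable_def by blast
qed

text \<open>
  Only one of \<open>x\<close> and \<open>x'\<close> can be equal to \<open>x2\<close>, and their roles can be interchanged.
\<close>

lemma star_attached_once:
  assumes "p \<in> V" "y \<in> V" "y \<noteq> p" "side y = side p"
    and "q \<in> V" "E y q" "\<not> E p q" "x2 \<in> V" "E p x2" "E y x2"
    and x: "x \<in> V" "E p x" and y1: "conn (far p - {y}) q y1" "E x y1"
    and x': "x' \<in> V" "E p x'" and y2: "conn (far p - {y}) q y2" "E x' y2"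
  shows "x' = x"
proof (rule ccontr)
  assume "x' \<noteq> x"
  then show False
    using star_not_attached_twice[OF assms(1-10), of x y1 x' y2] star_not_attached_twice[OF assms(1-10), of x' y2 x y1]
      assms by metis
qed

lemma far_side: "p \<in> V \<Longrightarrow> v \<in> V \<Longrightarrow> side v = side p \<Longrightarrow> v \<noteq> p \<Longrightarrow> v \<in> far p"
  using sides by (auto simp: far_def)

text \<open>
  Let \<open>y\<close> have two neighbours in common with \<open>p\<close>.  As \<open>y\<close> is no cut vertex, the component of \<open>q\<close> beyond
  \<open>y\<close> contains another vertex \<open>y1\<close> next to a neighbour of \<open>p\<close>.  With \<open>y1\<close> in the role of \<open>y\<close>, the
  component that contains \<open>y\<close> is attached to both common neighbours.
\<close>

lemma one_common_nbr:
  assumes p: "p \<in> V" and y: "y \<in> V" "y \<noteq> p" and q: "q \<in> V" "E y q" "\<not> E p q"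
    and x: "x \<in> V" "E p x" "E y x" and x': "x' \<in> V" "E p x'" "E y x'"
  shows "x' = x"
proof -
  have sy: "side y = side p" using sides[OF p x(1,2)] sides[OF y(1) x(1,3)] by auto
  have qy: "q \<noteq> y" using q adj_irrefl by auto
  have qp: "side q \<noteq> side p" using sides[OF y(1) q(1,2)] sy by auto
  then have qX: "q \<in> far p - {y}" using q qy by (auto simp: far_def)
  have "conn (V - {y}) q p" using no_cut y p q qy by simp
  then obtain y1 x1 where y1: "conn (far p - {y}) q y1" "y1 \<in> far p - {y}"
    and x1: "E y1 x1" "x1 \<in> V - {y}" "x1 \<notin> far p - {y}"
    using conn_exit[of "V - {y}" q p "far p - {y}"] qX by (auto simp: far_def)
  have y1V: "y1 \<in> V" "y1 \<noteq> p" "\<not> E p y1" "y1 \<noteq> y" using y1 by (auto simp: far_def)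
  have x1N: "x1 \<in> V" "E p x1" using x1 y1V adj_sym by (auto simp: far_def)
  have sy1: "side y1 = side p" using sides[OF y1V(1) x1N(1) x1(1)] sides[OF p x1N] by auto
  have "q \<noteq> y1" using sy1 qp by auto
  then obtain q1 where q1: "q1 \<in> far p - {y} - {y1}" "E q1 y1" "conn (far p - {y} - {y1}) q q1"
    using conn_last_step[OF y1(1)] by blast
  have "conn (far p - {y1}) q1 q"
    by (rule conn_mono[OF conn_sym[OF q1(3)]]) auto
  moreover have "conn (far p - {y1}) q y"
    using qX \<open>q \<noteq> y1\<close> far_side[OF p y(1) sy y(2)] y1V q adj_sym by (intro conn_edge) auto
  ultimately have c1: "conn (far p - {y1}) q1 y" by (rule conn_trans)
  show ?thesis
    by (rule star_attached_once[OF p y1V(1,2) sy1 _ adj_sym[OF q1(2)] _ x1N x1(1) x(1,2) c1 _ x'(1,2) c1])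
      (use q1 x x' adj_sym in \<open>auto simp: far_def\<close>)
qed

text \<open>
  As \<open>x\<close> is no cut vertex, the component of \<open>y\<close> and \<open>b\<close> has a vertex \<open>y1\<close> next to another neighbour \<open>x1\<close>
  of \<open>p\<close>.  Seen from \<open>y1\<close>, one of \<open>y\<close> and \<open>b\<close> is reached first.  Deleting the other one leaves a
  component that is attached to both \<open>x\<close> and \<open>x1\<close>.
\<close>

lemma one_nbr_beyond:
  assumes p: "p \<in> V" and x: "x \<in> V" "E p x"
    and y: "y \<in> far p" "E x y" and b: "b \<in> far p" "E x b" and yb: "conn (far p) y b"
  shows "y = b"
proof (rule ccontr)
  assume ne: "y \<noteq> b"
  have farV: "v \<in> V" "v \<noteq> p" "\<not> E p v" if "v \<in> far p" for v using that by (auto simp: far_def)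
  have sd: "side v = side p" if "v \<in> far p" "w \<in> V" "E p w" "E w v" for v w
    using that sides[OF p that(2,3)] sides[OF that(2) farV(1)[OF that(1)] that(4)] by auto
  have main: False
    if u: "u \<in> far p" "E x u" and v: "v \<in> far p" "E x v" "u \<noteq> v"
      and y1: "conn (far p - {u}) v y1" "E x1 y1" and x1: "x1 \<in> V" "E p x1" "x1 \<noteq> x"
      and uv: "conn (far p) v u" for u v x1 y1
  proof -
    obtain q where q: "q \<in> far p - {u}" "E q u" "conn (far p - {u}) v q"
      using conn_last_step[OF uv] v(3) by blast
    have qv: "conn (far p - {u}) q v" using q conn_sym by blast
    then have qy: "conn (far p - {u}) q y1" using y1 conn_trans by blast
    have "x1 = x"
      by (rule star_attached_once[OF p _ _ sd[OF u(1) x u(2)] _ adj_sym[OF q(2)] _ x adj_sym[OF u(2)]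
            x qv v(2) x1(1,2) qy y1(2)]) (use q u farV in auto)
    with x1 show False by simp
  qed
  have y_nbr: "\<exists>q. q \<in> V \<and> E y q \<and> \<not> E p q"
  proof -
    obtain q where "q \<in> far p" "E y q" using conn_first_step[OF yb ne] by blast
    then show ?thesis using farV by blast
  qed
  have b_nbr: "\<exists>q. q \<in> V \<and> E b q \<and> \<not> E p q"
  proof -
    obtain q where "q \<in> far p" "E b q" using conn_first_step[OF conn_sym[OF yb]] ne by blast
    then show ?thesis using farV by blast
  qed
  have "y \<noteq> x" "p \<noteq> x" using y x adj_irrefl by auto
  then have "conn (V - {x}) y p" using no_cut x y p farV by simp
  then obtain y1 x1 where y1: "conn (far p) y y1" "y1 \<in> far p"
    and x1: "E y1 x1" "x1 \<in> V - {x}" "x1 \<notin> far p"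
    using conn_exit[of "V - {x}" y p "far p"] y by (auto simp: far_def)
  have x1N: "x1 \<in> V" "E p x1" "x1 \<noteq> x" using x1 farV[OF y1(2)] adj_sym by (auto simp: far_def)
  have "y1 \<noteq> y"
    using one_common_nbr[OF p farV(1,2)[OF y(1)] _ _ _ x adj_sym[OF y(2)] x1N(1,2)] y_nbr x1 x1N by blast
  have "y1 \<noteq> b"
    using one_common_nbr[OF p farV(1,2)[OF b(1)] _ _ _ x adj_sym[OF b(2)] x1N(1,2)] b_nbr x1 x1N by blast
  have "conn (far p) y1 y" using y1 conn_sym by blast
  then have "conn (far p - {b}) y1 y \<or> conn (far p - {y}) y1 b"
    using conn_first_hit ne by blast
  then show False
  proof
    assume "conn (far p - {b}) y1 y"
    then show False
      using main[OF b y ne[symmetric] _ adj_sym[OF x1(1)] x1N yb] conn_sym by blast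
  next
    assume "conn (far p - {y}) y1 b"
    then show False
      using main[OF y b ne _ adj_sym[OF x1(1)] x1N conn_sym[OF yb]] conn_sym by blast
  qed
qed

text \<open>
  Let \<open>b\<close> be a third neighbour of \<open>x\<close>.  If \<open>p\<close> and \<open>b\<close> lie in the same component beyond the star of
  \<open>y\<close>, then \<open>one_nbr_beyond\<close> applies to that star.  Otherwise the component of \<open>b\<close> contains no neighbour of \<open>p\<close>, and it is attached to
  \<open>y\<close> by some vertex other than \<open>x\<close>; so \<open>b\<close> is connected to \<open>y\<close> beyond the star of \<open>p\<close>, and
  \<open>one_nbr_beyond\<close> applies to that star.
\<close>

lemma path_mid_degree:
  assumes p: "p \<in> V" and x: "x \<in> V" "E p x" and y: "y \<in> V" "E x y" "y \<noteq> p"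
    and q: "q \<in> V" "E y q" "\<not> E p q"
  shows "{v \<in> V. E x v} = {p, y}"
proof -
  have "b = p \<or> b = y" if b: "b \<in> V" "E x b" for b
  proof (rule ccontr)
    assume "\<not> (b = p \<or> b = y)"
    then have ne: "b \<noteq> p" "b \<noteq> y" by auto
    have sd: "side y = side p" "side b = side p" "side q \<noteq> side p" "side x \<noteq> side p"
      using sides[OF p x] sides[OF x(1) y(1,2)] sides[OF x(1) b] sides[OF y(1) q(1,2)] by auto
    have far: "y \<in> far p" "b \<in> far p" "q \<in> far p" "p \<in> far y" "b \<in> far y" "y \<in> far b"
      using far_side p y b ne sd q by (auto simp: far_def)
    have yx: "E y x" using y adj_sym by blast
    have only_py: "v = x" if "v \<in> V" "E p v" "E y v" for v
      by (rule one_common_nbr[OF p y(1,3) q x yx that])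
    have nbq: "\<not> E b q"
    proof
      assume "E b q"
      have "conn (far p) y q" "conn (far p) q b"
        using far q \<open>E b q\<close> adj_sym by (auto intro: conn_edge)
      then have "conn (far p) y b" by (rule conn_trans)
      then show False using one_nbr_beyond[OF p x far(1) y(2) far(2) b(2)] ne by simp
    qed
    have only_by: "v = x" if "v \<in> V" "E b v" "E y v" for v
      by (rule one_common_nbr[OF b(1) y(1) ne(2)[symmetric] q(1,2) nbq x(1) adj_sym[OF b(2)] yx that])
    show False
    proof (cases "conn (far y) p b")
      case True
      then show False
        using one_nbr_beyond[OF y(1) x(1) yx far(4) adj_sym[OF x(2)] far(5) b(2)] ne by simp
    next
      case False
      have avoid: "w \<in> far p" if "conn (far y) b w" for w
      proof -
        have w: "w \<in> far y" using conn_mem[OF that far(5)] .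
        have "w \<noteq> p" using that False conn_sym by blast
        moreover have "\<not> E p w"
        proof
          assume "E p w"
          then have "conn (far y) w p" using w far adj_sym by (intro conn_edge) auto
          with that False show False using conn_trans conn_sym by blast
        qed
        ultimately show ?thesis using w by (auto simp: far_def)
      qed
      have "b \<noteq> x" "y \<noteq> x" using b y adj_irrefl by auto
      then have "conn (V - {x}) b y" using no_cut x b y by simp
      then obtain u s where u: "conn (far y) b u" "u \<in> far y" and s: "E u s" "s \<in> V - {x}" "s \<notin> far y"
        using conn_exit[of "V - {x}" b y "far y"] far(5) by (auto simp: far_def)
      have sN: "E y s" using s u(2) adj_sym by (auto simp: far_def)
      have "side s \<noteq> side p" using sides[OF y(1) _ sN] s sd by auto
      moreover have "\<not> E p s" using only_py[of s] s sN by auto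
      ultimately have sfar: "s \<in> far p" using s by (auto simp: far_def)
      have "conn (far p) b u"
        using conn_avoid[OF u(1)] avoid by blast
      also have "conn (far p) u s" using avoid[OF u(1)] sfar s by (intro conn_edge) auto
      also have "conn (far p) s y" using sfar far sN adj_sym by (intro conn_edge) auto
      finally show False
        using one_nbr_beyond[OF p x far(2) b(2) far(1) y(2)] ne by simp
    qed
  qed
  then show ?thesis using assms adj_sym by auto
qed

text \<open>
  \<open>x\<close> is an inner vertex of an induced path on four vertices \<open>p, x, y, q\<close>; in a bipartite graph, \<open>p\<close> and
  \<open>q\<close> being non-adjacent is enough for the path to be induced.
\<close>

definition on_path4 :: "'a \<Rightarrow> bool" where
  "on_path4 x \<longleftrightarrow> (\<exists>p y q. p \<in> V \<and> x \<in> V \<and> y \<in> V \<and> q \<in> V \<and>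
     E p x \<and> E x y \<and> y \<noteq> p \<and> E y q \<and> \<not> E p q)"

text \<open>
  The only neighbours of \<open>x\<close> are \<open>p\<close> and \<open>y\<close>.  A second neighbour of \<open>p\<close> in front of the path makes \<open>p\<close> an
  inner vertex of the induced path that consists of it, \<open>p\<close>, \<open>x\<close> and \<open>y\<close>.  For \<open>y\<close>, read the path backwards.
\<close>

lemma on_path4_step:
  assumes "on_path4 x" "w \<in> V" "E x w"
  shows "on_path4 w"
proof -
  obtain p y q where P: "p \<in> V" "x \<in> V" "y \<in> V" "q \<in> V" "E p x" "E x y" "y \<noteq> p" "E y q" "\<not> E p q"
    using assms by (auto simp: on_path4_def)
  have "w \<in> {p, y}"
    using path_mid_degree[OF P(1,2,5,3,6,7,4,8,9)] assms by blast
  then show ?thesis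
  proof
    assume w: "w = p"
    have xy: "x \<noteq> y" "x \<noteq> p" using P adj_irrefl by auto
    have "conn (V - {x}) p y" using no_cut[of x p y] P xy by simp
    then obtain s where s: "s \<in> V" "s \<noteq> x" "E p s"
      using conn_first_step[of "V - {x}" p y] P by blast
    have "\<not> E s y"
    proof
      assume "E s y"
      then have "s = x"
        using one_common_nbr[of p y q x s] P s adj_sym by blast
      with s show False by simp
    qed
    then show ?thesis
      unfolding on_path4_def w using P s adj_sym by blast
  next
    assume "w \<in> {y}"
    then have "w = y" by simp
    moreover have "q \<noteq> x" using P by auto
    ultimately show ?thesis
      unfolding on_path4_def using P adj_sym by blast
  qed
qed

lemma not_forced:
  assumes "V \<noteq> {}"
  shows "\<not> forced V c d"
proof (cases "\<exists>x. on_path4 x")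
  case True
  then obtain x where x: "on_path4 x" by blast
  then have "x \<in> V" by (auto simp: on_path4_def)
  show ?thesis
  proof (rule two_regular_not_forced[OF finite_V assms])
    fix v assume "v \<in> V"
    have "on_path4 v"
      using connected[OF \<open>x \<in> V\<close> \<open>v \<in> V\<close>]
      by (induction rule: conn_induct) (use x on_path4_step in blast)+
    then obtain p y q where P: "p \<in> V" "v \<in> V" "y \<in> V" "q \<in> V" "E p v" "E v y" "y \<noteq> p" "E y q" "\<not> E p q"
      by (auto simp: on_path4_def)
    then show "\<exists>u w. u \<noteq> w \<and> {x \<in> V. E v x} = {u, w}"
      using path_mid_degree[OF P(1,2,5,3,6,7,4,8,9)] by blast
  qed
next
  case False
  have step: "E u w" if "u \<in> V" "v \<in> V" "x \<in> V" "w \<in> V" "E u v" "E v x" "E x w" for u v x w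
    using False that unfolding on_path4_def by blast
  have all: "v = u \<or> E u v \<or> (\<exists>w\<in>V. E u w \<and> E w v)" if "u \<in> V" "v \<in> V" for u v
    using connected[OF that]
  proof (induction rule: conn_induct)
    case (step y w)
    then show ?case using that \<open>\<And>u v x w. u \<in> V \<Longrightarrow> v \<in> V \<Longrightarrow> x \<in> V \<Longrightarrow> w \<in> V \<Longrightarrow> E u v \<Longrightarrow> E v x \<Longrightarrow> E x w \<Longrightarrow> E u w\<close> by blast
  qed simp
  show ?thesis
  proof (rule complete_bipartite_not_forced[OF assms, of side])
    fix u v assume uv: "u \<in> V" "v \<in> V"
    show "E u v \<longleftrightarrow> side u \<noteq> side v"
      using all[OF uv] sides uv by metis
  qed
qed

end

section \<open>Separated parts and cut vertices\<close>

context adjacency begin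

lemma exchange_eq_iff: "exchange a b m = exchange a b n \<longleftrightarrow> m = n"
  by (auto simp: exchange_def)

lemma flip_set_exists:
  assumes "proper V c" "\<And>v. v \<in> V \<Longrightarrow> d v \<noteq> c v" "\<not> forced V c d"
  obtains S s where "S \<subseteq> V" "s \<in> S"
    "\<And>u v. u \<in> S \<Longrightarrow> v \<in> V \<Longrightarrow> E u v \<Longrightarrow> c v = d u \<Longrightarrow> v \<in> S"
    "\<And>u v. u \<in> S \<Longrightarrow> v \<in> S \<Longrightarrow> E u v \<Longrightarrow> d u \<noteq> d v"
  using assms forcedI[of V c d] by metis

lemma forced_subset_of_separated:
  assumes F: "forced (V1 \<union> V2) c d" and sep: "\<And>u v. u \<in> V1 \<Longrightarrow> v \<in> V2 \<Longrightarrow> \<not> E u v"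
  shows "forced V1 c d"
proof (rule forcedI)
  show "proper V1 c" using F proper_subset by (auto simp: forced_def)
  show "d v \<noteq> c v" if "v \<in> V1" for v using F that by (auto simp: forced_def)
  fix S s
  assume S: "S \<subseteq> V1" "s \<in> S" "\<And>u v. u \<in> S \<Longrightarrow> v \<in> V1 \<Longrightarrow> E u v \<Longrightarrow> c v = d u \<Longrightarrow> v \<in> S"
    "\<And>u v. u \<in> S \<Longrightarrow> v \<in> S \<Longrightarrow> E u v \<Longrightarrow> d u \<noteq> d v"
  show False
    by (rule forcedD[OF F, of S s]) (use S sep in blast)+
qed

text \<open>
  If both parts have a switchable set, each of these must contain \<open>z\<close>, as it would otherwise be
  switchable in the whole graph.  But then the two sets agree at \<open>z\<close> and their union is switchable.
\<close>

lemma forced_cut_vertex: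
  assumes F: "forced (V1 \<union> V2) c d" and cut: "V1 \<inter> V2 = {z}"
    and sep: "\<And>u v. u \<in> V1 - {z} \<Longrightarrow> v \<in> V2 - {z} \<Longrightarrow> \<not> E u v"
  shows "forced V1 c d \<or> forced V2 c d"
proof (rule ccontr)
  assume neg: "\<not> ?thesis"
  have pc: "proper V1 c" "proper V2 c" and dc: "\<And>v. v \<in> V1 \<union> V2 \<Longrightarrow> d v \<noteq> c v"
    using F proper_subset by (auto simp: forced_def)
  obtain S1 s1 where S1: "S1 \<subseteq> V1" "s1 \<in> S1"
    "\<And>u v. u \<in> S1 \<Longrightarrow> v \<in> V1 \<Longrightarrow> E u v \<Longrightarrow> c v = d u \<Longrightarrow> v \<in> S1"
    "\<And>u v. u \<in> S1 \<Longrightarrow> v \<in> S1 \<Longrightarrow> E u v \<Longrightarrow> d u \<noteq> d v"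
    by (rule flip_set_exists[OF pc(1), of d]) (use neg dc in blast)+
  obtain S2 s2 where S2: "S2 \<subseteq> V2" "s2 \<in> S2"
    "\<And>u v. u \<in> S2 \<Longrightarrow> v \<in> V2 \<Longrightarrow> E u v \<Longrightarrow> c v = d u \<Longrightarrow> v \<in> S2"
    "\<And>u v. u \<in> S2 \<Longrightarrow> v \<in> S2 \<Longrightarrow> E u v \<Longrightarrow> d u \<noteq> d v"
    by (rule flip_set_exists[OF pc(2), of d]) (use neg dc in blast)+
  have sep': "\<not> E u v" if "u \<in> V2 - {z}" "v \<in> V1 - {z}" for u v
    using sep[OF that(2,1)] adj_sym by blast
  have z1: "z \<in> S1"
  proof (rule ccontr)
    assume "z \<notin> S1"
    show False
    proof (rule forcedD[OF F, of S1 s1])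
      show "v \<in> S1" if "u \<in> S1" "v \<in> V1 \<union> V2" "E u v" "c v = d u" for u v
        using that S1(1) S1(3)[of u v] sep[of u v] cut \<open>z \<notin> S1\<close> by blast
    qed (use S1 in blast)+
  qed
  have z2: "z \<in> S2"
  proof (rule ccontr)
    assume "z \<notin> S2"
    show False
    proof (rule forcedD[OF F, of S2 s2])
      show "v \<in> S2" if "u \<in> S2" "v \<in> V1 \<union> V2" "E u v" "c v = d u" for u v
        using that S2(1) S2(3)[of u v] sep'[of u v] cut \<open>z \<notin> S2\<close> by blast
    qed (use S2 in blast)+
  qed
  show False
  proof (rule forcedD[OF F, of "S1 \<union> S2" z])
    show "v \<in> S1 \<union> S2" if "u \<in> S1 \<union> S2" "v \<in> V1 \<union> V2" "E u v" "c v = d u" for u v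
    proof (cases "v = z")
      case False
      then show ?thesis
        using that S1(1) S2(1) S1(3)[of u v] S2(3)[of u v] sep[of u v] sep'[of u v] z1 z2 by blast
    qed (use z1 in simp)
    show "d u \<noteq> d v" if "u \<in> S1 \<union> S2" "v \<in> S1 \<union> S2" "E u v" for u v
      using that S1(1) S2(1) S1(4)[of u v] S2(4)[of u v] sep[of u v] sep'[of u v] z1 z2 by blast
  qed (use S1 S2 z1 in auto)
qed

lemma forceable_disjoint_union:
  assumes "forceable t V1" "forceable t V2" "V1 \<inter> V2 = {}"
    and sep: "\<And>u v. u \<in> V1 \<Longrightarrow> v \<in> V2 \<Longrightarrow> \<not> E u v"
  shows "forceable t (V1 \<union> V2)"
proof -
  obtain c1 d1 where F1: "forced V1 c1 d1" "c1 ` V1 \<subseteq> {..<t}" "d1 ` V1 \<subseteq> {..<t}"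
    using assms(1) by (auto simp: forceable_def)
  obtain c2 d2 where F2: "forced V2 c2 d2" "c2 ` V2 \<subseteq> {..<t}" "d2 ` V2 \<subseteq> {..<t}"
    using assms(2) by (auto simp: forceable_def)
  define c where "c = (\<lambda>v. if v \<in> V1 then c1 v else c2 v)"
  define d where "d = (\<lambda>v. if v \<in> V1 then d1 v else d2 v)"
  have on1: "c v = c1 v" "d v = d1 v" if "v \<in> V1" for v using that by (simp_all add: c_def d_def)
  have on2: "c v = c2 v" "d v = d2 v" if "v \<in> V2" for v
    using that assms(3) by (auto simp: c_def d_def)
  have sep': "\<not> E u v" if "u \<in> V2" "v \<in> V1" for u v using sep[OF that(2,1)] adj_sym by blast
  have pc: "proper V1 c1" "proper V2 c2" using F1(1) F2(1) by (simp_all add: forced_def)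
  have dc: "\<And>v. v \<in> V1 \<Longrightarrow> d1 v \<noteq> c1 v" "\<And>v. v \<in> V2 \<Longrightarrow> d2 v \<noteq> c2 v"
    using F1(1) F2(1) by (simp_all add: forced_def)
  have "forced (V1 \<union> V2) c d"
  proof (rule forcedI)
    show "proper (V1 \<union> V2) c"
      unfolding proper_def
      using properD[OF pc(1)] properD[OF pc(2)] on1 on2 sep sep' by (metis UnE)
    show "d v \<noteq> c v" if "v \<in> V1 \<union> V2" for v
      using that dc on1 on2 by (metis UnE)
    fix S s
    assume S: "S \<subseteq> V1 \<union> V2" "s \<in> S"
      "\<And>u v. u \<in> S \<Longrightarrow> v \<in> V1 \<union> V2 \<Longrightarrow> E u v \<Longrightarrow> c v = d u \<Longrightarrow> v \<in> S"
      "\<And>u v. u \<in> S \<Longrightarrow> v \<in> S \<Longrightarrow> E u v \<Longrightarrow> d u \<noteq> d v"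
    show False
    proof (cases "s \<in> V1")
      case True
      show False
      proof (rule forcedD[OF F1(1), of "S \<inter> V1" s])
        show "v \<in> S \<inter> V1" if "u \<in> S \<inter> V1" "v \<in> V1" "E u v" "c1 v = d1 u" for u v
          using that S(3)[of u v] on1 by auto
        show "d1 u \<noteq> d1 v" if "u \<in> S \<inter> V1" "v \<in> S \<inter> V1" "E u v" for u v
          using that S(4)[of u v] on1 by auto
      qed (use S True in auto)
    next
      case False
      show False
      proof (rule forcedD[OF F2(1), of "S \<inter> V2" s])
        show "v \<in> S \<inter> V2" if "u \<in> S \<inter> V2" "v \<in> V2" "E u v" "c2 v = d2 u" for u v
          using that S(3)[of u v] on2 by auto
        show "d2 u \<noteq> d2 v" if "u \<in> S \<inter> V2" "v \<in> S \<inter> V2" "E u v" for u v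
          using that S(4)[of u v] on2 by auto
      qed (use S False in auto)
    qed
  qed
  moreover have "c ` (V1 \<union> V2) \<subseteq> {..<t}" "d ` (V1 \<union> V2) \<subseteq> {..<t}"
    using F1 F2 on1 on2 by (auto simp: image_subset_iff)
  ultimately show ?thesis unfolding forceable_def by blast
qed

text \<open>
  Renaming colours makes the two colourings agree at \<open>z\<close>, and the vertices of \<open>V2\<close> point towards \<open>z\<close>.
  A switched vertex of \<open>V2\<close> thus switches \<open>z\<close>, hence a nonempty set in \<open>V1\<close>.
\<close>

lemma forceable_attach:
  assumes "forceable t V1" and p2: "proper V2 c2" and t2: "c2 ` V2 \<subseteq> {..<t}"
    and cut: "V1 \<inter> V2 = {z}"
    and sep: "\<And>u v. u \<in> V1 - {z} \<Longrightarrow> v \<in> V2 - {z} \<Longrightarrow> \<not> E u v"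
    and con: "\<And>v. v \<in> V2 \<Longrightarrow> conn V2 v z"
  shows "forceable t (V1 \<union> V2)"
proof -
  obtain c1 d1 where F1: "forced V1 c1 d1" "c1 ` V1 \<subseteq> {..<t}" "d1 ` V1 \<subseteq> {..<t}"
    using assms(1) by (auto simp: forceable_def)
  have p1: "proper V1 c1" using F1 by (simp add: forced_def)
  have z: "z \<in> V1" "z \<in> V2" using cut by auto
  have lt: "c1 z < t" "c2 z < t" using z F1 t2 by auto
  define c2' where "c2' = (\<lambda>v. exchange (c2 z) (c1 z) (c2 v))"
  have p2': "proper V2 c2'"
    using p2 by (simp add: proper_def c2'_def exchange_eq_iff)
  have t2': "c2' v < t" if "v \<in> V2" for v using that t2 lt by (auto simp: c2'_def exchange_def)
  define c where "c = (\<lambda>v. if v \<in> V1 then c1 v else c2' v)"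
  have "\<exists>w\<in>{z}. conn V2 v w" if "v \<in> V2" for v
    using con[OF that] by blast
  then obtain par where par: "\<And>v. v \<in> V2 - {z} \<Longrightarrow> par v \<in> V2 \<and> E v (par v)"
    and reach: "\<And>v. v \<in> V2 \<Longrightarrow> \<exists>w\<in>{z}. \<forall>S. v \<in> S \<longrightarrow> (\<forall>u \<in> S \<inter> (V2 - {z}). par u \<in> S) \<longrightarrow> w \<in> S"
    by (rule parents[of V2 "{z}"]) blast+
  define d where "d = (\<lambda>v. if v \<in> V1 then d1 v else c (par v))"
  have on1: "c v = c1 v" "d v = d1 v" if "v \<in> V1" for v using that by (simp_all add: c_def d_def)
  have on2: "c v = c2' v" if "v \<in> V2" for v
  proof (cases "v \<in> V1")
    case True
    then have "v = z" using that cut by blast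
    then show ?thesis using True by (simp add: c_def c2'_def exchange_def)
  qed (simp add: c_def)
  have pc: "proper (V1 \<union> V2) c"
    unfolding proper_def
  proof (intro ballI impI)
    fix u v assume uv: "u \<in> V1 \<union> V2" "v \<in> V1 \<union> V2" "E u v"
    then have "u \<in> V1 \<and> v \<in> V1 \<or> u \<in> V2 \<and> v \<in> V2"
      using sep[of u v] sep[of v u] adj_sym[of u v] z by blast
    then show "c u \<noteq> c v"
    proof
      assume "u \<in> V1 \<and> v \<in> V1"
      then show ?thesis using properD[OF p1, of u v] uv(3) on1(1) by metis
    next
      assume "u \<in> V2 \<and> v \<in> V2"
      then show ?thesis using properD[OF p2', of u v] uv(3) on2 by metis
    qed
  qed
  have "forced (V1 \<union> V2) c d"
  proof (rule forcedI[OF pc])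
    show "d v \<noteq> c v" if "v \<in> V1 \<union> V2" for v
    proof (cases "v \<in> V1")
      case True
      moreover have "d1 v \<noteq> c1 v" using F1(1) True by (simp add: forced_def)
      ultimately show ?thesis using on1 by simp
    next
      case False
      then have "v \<in> V2 - {z}" using that z by auto
      then show ?thesis
        using par[of v] properD[OF pc, of v "par v"] False by (auto simp: d_def)
    qed
    fix S s
    assume S: "S \<subseteq> V1 \<union> V2" "s \<in> S"
      "\<And>u v. u \<in> S \<Longrightarrow> v \<in> V1 \<union> V2 \<Longrightarrow> E u v \<Longrightarrow> c v = d u \<Longrightarrow> v \<in> S"
      "\<And>u v. u \<in> S \<Longrightarrow> v \<in> S \<Longrightarrow> E u v \<Longrightarrow> d u \<noteq> d v"
    have "\<exists>s. s \<in> S \<inter> V1"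
    proof (cases "s \<in> V1")
      case False
      then have "s \<in> V2" using S by auto
      moreover have "\<forall>u \<in> S \<inter> (V2 - {z}). par u \<in> S"
      proof
        fix u assume u: "u \<in> S \<inter> (V2 - {z})"
        then have "u \<notin> V1" using cut by blast
        then show "par u \<in> S" using S(3)[of u "par u"] par[of u] u by (auto simp: d_def)
      qed
      ultimately have "z \<in> S" using reach[of s] S(2) by blast
      with z show ?thesis by blast
    qed (use S in blast)
    then obtain s where s: "s \<in> S \<inter> V1" ..
    show False
    proof (rule forcedD[OF F1(1), of "S \<inter> V1" s])
      show "v \<in> S \<inter> V1" if "u \<in> S \<inter> V1" "v \<in> V1" "E u v" "c1 v = d1 u" for u v
        using that S(3)[of u v] on1 by auto
      show "d1 u \<noteq> d1 v" if "u \<in> S \<inter> V1" "v \<in> S \<inter> V1" "E u v" for u v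
        using that S(4)[of u v] on1 by auto
    qed (use s in auto)
  qed
  moreover have ct: "c v < t" if "v \<in> V1 \<union> V2" for v
    using that F1(2) t2' by (auto simp: c_def)
  moreover have "d v < t" if "v \<in> V1 \<union> V2" for v
  proof (cases "v \<in> V1")
    case True
    then show ?thesis using F1(3) on1 by auto
  next
    case False
    then have "v \<in> V2 - {z}" using that z by auto
    then show ?thesis using ct[of "par v"] par[of v] False by (auto simp: d_def)
  qed
  ultimately show ?thesis unfolding forceable_def by blast
qed

lemma forceable_mono: "forceable s V \<Longrightarrow> s \<le> t \<Longrightarrow> forceable t V"
  unfolding forceable_def by (meson lessThan_subset_iff order_trans)

lemma conn_cut_side:
  assumes "x \<in> C" "conn V x z" "z \<notin> C" "\<And>u v. u \<in> C \<Longrightarrow> v \<in> V - {z} \<Longrightarrow> E u v \<Longrightarrow> v \<in> C"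
  shows "conn (insert z C) x z"
proof -
  obtain y w where yw: "conn C x y" "y \<in> C" "E y w" "w \<in> V" "w \<notin> C"
    using conn_exit[OF assms(2,1,3)] by blast
  then have "w = z" using assms(4) by blast
  have "conn (insert z C) x y" using yw(1) by (rule conn_mono) auto
  moreover have "conn (insert z C) y z" using yw \<open>w = z\<close> by (intro conn_edge) auto
  ultimately show ?thesis by (rule conn_trans)
qed

lemma forceable_two_connected:
  assumes fin: "finite V" and ne: "V \<noteq> {}" and t3: "3 \<le> t"
    and col: "proper V c0" "c0 ` V \<subseteq> {..<t}"
    and F: "forced V c d"
    and con: "\<And>u v. u \<in> V \<Longrightarrow> v \<in> V \<Longrightarrow> conn V u v"
    and con2: "\<And>z u v. z \<in> V \<Longrightarrow> u \<in> V - {z} \<Longrightarrow> v \<in> V - {z} \<Longrightarrow> conn (V - {z}) u v"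
  shows "forceable t V"
proof (rule ccontr)
  assume nf: "\<not> forceable t V"
  show False
  proof (cases "\<exists>c. proper V c \<and> c ` V \<subseteq> {..<2}")
    case True
    then obtain b where b: "proper V b" "b ` V \<subseteq> {..<2}" by blast
    interpret bipartite_unforceable E V "\<lambda>v. b v = 0"
    proof unfold_locales
      show "(b u = 0) \<noteq> (b v = 0)" if "u \<in> V" "v \<in> V" "E u v" for u v
      proof -
        have "b u < 2" "b v < 2" using b that by auto
        then show ?thesis using properD[OF b(1) that] by auto
      qed
      show "\<not> forceable 3 V" using nf forceable_mono t3 by blast
    qed (use fin con con2 in auto)
    show False using not_forced[OF ne] F by blast
  next
    case False
    define P where "P = (\<lambda>n. \<exists>c. proper V c \<and> c ` V \<subseteq> {..<n})"
    define m where "m = (LEAST n. P n)"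
    have "P t" using col by (auto simp: P_def)
    then have Pm: "P m" and mt: "m \<le> t" unfolding m_def by (auto intro: LeastI Least_le)
    have "2 < m"
    proof (rule ccontr)
      assume "\<not> 2 < m"
      then have "{..<m} \<subseteq> {..<2}" by auto
      moreover obtain b where "proper V b" "b ` V \<subseteq> {..<m}" using Pm by (auto simp: P_def)
      ultimately have "P 2" unfolding P_def by (meson subset_trans)
      with False show False unfolding P_def by blast
    qed
    interpret unforceable E V m
    proof unfold_locales
      show "\<exists>c. proper V c \<and> c ` V \<subseteq> {..<m}" using Pm by (simp add: P_def)
      have "\<not> P (m - 1)"
        using not_less_Least[of "m - 1" P] \<open>2 < m\<close> by (auto simp: m_def)
      then show "\<not> (\<exists>c. proper V c \<and> c ` V \<subseteq> {..<m - 1})" by (simp add: P_def)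
      show "\<not> forceable m V" using nf forceable_mono mt by blast
    qed (use fin con con2 \<open>2 < m\<close> in auto)
    show False using not_forced F by blast
  qed
qed

text \<open>
  Induction on the number of vertices.  The colouring \<open>c0\<close> supplies the colours on the parts that are
  attached to a solution, whereas \<open>(c, d)\<close>, with unboundedly many colours, decides which part
  has one.
\<close>

theorem forced_imp_forceable:
  assumes "finite V" "3 \<le> t" "proper V c0" "c0 ` V \<subseteq> {..<t}" "forced V c d"
  shows "forceable t V"
  using assms(1,3-5)
proof (induction "card V" arbitrary: V rule: less_induct)
  case less
  note fin = less.prems(1) and p0 = less.prems(2) and t0 = less.prems(3) and F = less.prems(4)
  have IH: "forceable t W" if "W \<subset> V" "forced W c d" for W
  proof (rule less.hyps)
    have "W \<subseteq> V" using that by auto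
    show "card W < card V" using psubset_card_mono[OF fin] that by blast
    show "finite W" using \<open>W \<subseteq> V\<close> fin by (rule finite_subset)
    show "proper W c0" using p0 \<open>W \<subseteq> V\<close> by (rule proper_subset)
    show "c0 ` W \<subseteq> {..<t}" using \<open>W \<subseteq> V\<close> t0 by auto
    show "forced W c d" using that by simp
  qed
  consider (empty) "V = {}"
    | (disconnected) u v where "u \<in> V" "v \<in> V" "\<not> conn V u v"
    | (cut) z u v where "\<And>u v. u \<in> V \<Longrightarrow> v \<in> V \<Longrightarrow> conn V u v"
        "z \<in> V" "u \<in> V - {z}" "v \<in> V - {z}" "\<not> conn (V - {z}) u v"
    | (two_connected) "V \<noteq> {}" "\<And>u v. u \<in> V \<Longrightarrow> v \<in> V \<Longrightarrow> conn V u v"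
        "\<And>z u v. z \<in> V \<Longrightarrow> u \<in> V - {z} \<Longrightarrow> v \<in> V - {z} \<Longrightarrow> conn (V - {z}) u v"
    by metis
  then show ?case
  proof cases
    case empty
    then show ?thesis using F by (auto simp: forceable_def)
  next
    case disconnected
    define V1 where "V1 = {w \<in> V. conn V u w}"
    define V2 where "V2 = V - V1"
    have V: "V = V1 \<union> V2" "V1 \<inter> V2 = {}" by (auto simp: V1_def V2_def)
    have sep: "\<not> E x y" if "x \<in> V1" "y \<in> V2" for x y
    proof
      assume "E x y"
      then have "conn V x y" using that by (intro conn_edge) (auto simp: V1_def V2_def)
      then show False using that conn_trans unfolding V1_def V2_def by blast
    qed
    have sep': "\<not> E x y" if "x \<in> V2" "y \<in> V1" for x y using sep[OF that(2,1)] adj_sym by blast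
    have "forced V1 c d" using forced_subset_of_separated[of V1 V2] F V sep by simp
    moreover have "forced V2 c d"
      using forced_subset_of_separated[of V2 V1] F V sep' by (simp add: Un_commute)
    moreover have "u \<in> V1" "v \<in> V2" using disconnected by (simp_all add: V1_def V2_def)
    then have "V1 \<subset> V" "V2 \<subset> V" using V by blast+
    ultimately have "forceable t V1" "forceable t V2" using IH by auto
    from forceable_disjoint_union[OF this V(2) sep] show ?thesis using V(1) by simp
  next
    case cut
    define C where "C = {w \<in> V - {z}. conn (V - {z}) u w}"
    define B where "B = V - {z} - C"
    have sep: "\<not> E x y" if "x \<in> C" "y \<in> B" for x y
    proof
      assume "E x y"
      then have "conn (V - {z}) x y" using that by (intro conn_edge) (auto simp: C_def B_def)
      then show False using that conn_trans unfolding C_def B_def by blast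
    qed
    have sep': "\<not> E x y" if "x \<in> B" "y \<in> C" for x y using sep[OF that(2,1)] adj_sym by blast
    have u: "u \<in> C" and v: "v \<in> B" using cut by (auto simp: C_def B_def)
    have z: "z \<notin> C" "z \<notin> B" by (auto simp: C_def B_def)
    have V: "V = insert z C \<union> insert z B" using cut(2) by (auto simp: C_def B_def)
    have I: "insert z C \<inter> insert z B = {z}" using z by (auto simp: B_def)
    have conC: "conn (insert z C) x z" if "x \<in> insert z C" for x
    proof (cases "x = z")
      case False
      show ?thesis
      proof (rule conn_cut_side)
        show "x \<in> C" using that False by simp
        then show "conn V x z" using cut(1,2) V by blast
        show "v' \<in> C" if "u' \<in> C" "v' \<in> V - {z}" "E u' v'" for u' v'
          using sep that by (auto simp: B_def)
      qed (rule z)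
    qed simp
    have conB: "conn (insert z B) x z" if "x \<in> insert z B" for x
    proof (cases "x = z")
      case False
      show ?thesis
      proof (rule conn_cut_side)
        show "x \<in> B" using that False by simp
        then show "conn V x z" using cut(1,2) V by blast
        show "v' \<in> B" if "u' \<in> B" "v' \<in> V - {z}" "E u' v'" for u' v'
          using sep' that by (auto simp: B_def)
      qed (rule z)
    qed simp
    have "u \<notin> insert z B" "v \<notin> insert z C" using u v z by (auto simp: B_def)
    then have sub: "insert z C \<subset> V" "insert z B \<subset> V" using V u v by blast+
    have "forced (insert z C) c d \<or> forced (insert z B) c d"
      by (rule forced_cut_vertex[OF _ I]) (use F V sep in auto)
    then show ?thesis
    proof
      assume "forced (insert z C) c d"
      with IH sub have f: "forceable t (insert z C)" by blast
      have "insert z B \<subseteq> V" using sub by blast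
      then have "proper (insert z B) c0" "c0 ` insert z B \<subseteq> {..<t}"
        using proper_subset[OF p0] t0 by blast+
      from forceable_attach[OF f this I _ conB] have "forceable t (insert z C \<union> insert z B)"
        using sep by simp
      then show ?thesis using V by simp
    next
      assume "forced (insert z B) c d"
      with IH sub have f: "forceable t (insert z B)" by blast
      have "insert z C \<subseteq> V" using sub by blast
      then have "proper (insert z C) c0" "c0 ` insert z C \<subseteq> {..<t}"
        using proper_subset[OF p0] t0 by blast+
      moreover have "insert z B \<inter> insert z C = {z}" using I by blast
      ultimately have "forceable t (insert z B \<union> insert z C)"
        using forceable_attach[OF f, of "insert z C" c0 z] sep' conC by simp
      moreover have "V = insert z B \<union> insert z C" using V by blast
      ultimately show ?thesis by simp
    qed
  next
    case two_connected
    then show ?thesis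
      using forceable_two_connected[OF fin _ assms(2) p0 t0 F] by blast
  qed
qed

end

section \<open>Unique list colourability with few colours\<close>

theorem theorem11:
  fixes G :: "('a, 'b) pre_digraph" and t :: nat
  assumes "graph G"
    and "t = max 3 (chromatic_number G)"
  shows "uniquely_list_colorable 2 G \<longleftrightarrow> uniquely_kt_list_colorable 2 t G"
proof
  show "uniquely_list_colorable 2 G" if "uniquely_kt_list_colorable 2 t G"
    using that by (auto simp: uniquely_list_colorable_def)
next
  assume ulc: "uniquely_list_colorable 2 G"
  interpret G: graph G by (rule assms(1))
  let ?V = "verts G"
  define E where "E = (\<lambda>u v. u \<rightarrow>\<^bsub>G\<^esub> v)"
  interpret adjacency E
  proof
    show "E v u" if "E u v" for u v
      using that G.sym_arcs unfolding E_def symmetric_def sym_def by blast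
    show "\<not> E u u" for u
      unfolding E_def using G.adj_not_same by blast
  qed
  have fin: "finite ?V" by simp
  have proper_iff: "proper_coloring G c \<longleftrightarrow> proper ?V c" for c
    unfolding proper_coloring_def proper_def by (simp add: E_def)
  obtain t0 L0 c0 where L0: "list_assignment 2 t0 G L0" and c0: "c0 \<in> list_colorings G L0"
    and uniq0: "\<And>c. c \<in> list_colorings G L0 \<Longrightarrow> c = c0"
    using ulc unfolding uniquely_list_colorable_def uniquely_kt_list_colorable_def by blast
  have ne: "?V \<noteq> {}" using L0 by (auto simp: list_assignment_def)
  have "\<exists>x. x \<noteq> c0 v \<and> L0 v = {c0 v, x}" if "v \<in> ?V" for v
  proof -
    have "card (L0 v) = 2" "c0 v \<in> L0 v"
      using that L0 c0 by (auto simp: list_assignment_def list_colorings_def)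
    then show ?thesis by (metis card_2_iff doubleton_eq_iff insertE singletonD)
  qed
  then obtain d0 where d0: "\<And>v. v \<in> ?V \<Longrightarrow> d0 v \<noteq> c0 v \<and> L0 v = {c0 v, d0 v}"
    by metis
  have p0: "proper ?V c0" using c0 by (simp add: list_colorings_def proper_iff)
  have forced0: "forced ?V c0 d0"
    unfolding forced_def
  proof (intro conjI allI impI ballI)
    fix c v assume c: "proper ?V c" "\<forall>v\<in>?V. c v = c0 v \<or> c v = d0 v" and v: "v \<in> ?V"
    have "proper ?V (restrict c ?V)" using c(1) by (simp add: proper_def)
    moreover have "restrict c ?V \<in> PiE ?V L0" using c(2) d0 by auto
    ultimately have "restrict c ?V = c0"
      using uniq0 by (simp add: list_colorings_def proper_iff)
    with v show "c v = c0 v" by (metis restrict_apply')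
  qed (use p0 d0 in auto)
  have colorable_card: "colorable G (card (c ` ?V))" if "proper ?V c" for c
  proof -
    obtain f where f: "bij_betw f (c ` ?V) {..<card (c ` ?V)}"
      using ex_bij_betw_finite_nat[of "c ` ?V"] fin by (auto simp: atLeast0LessThan)
    then have "proper ?V (f \<circ> c)"
      using that by (auto simp: proper_def bij_betw_def inj_on_eq_iff)
    moreover have "(f \<circ> c) ` ?V \<subseteq> {..<card (c ` ?V)}"
      using f by (auto simp: bij_betw_def)
    ultimately show ?thesis unfolding colorable_def proper_iff by blast
  qed
  have "colorable G (chromatic_number G)"
    unfolding chromatic_number_def using colorable_card[OF p0] by (rule LeastI)
  then obtain b where b: "proper ?V b" "b ` ?V \<subseteq> {..<chromatic_number G}"
    by (auto simp: colorable_def proper_iff)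
  then have "b ` ?V \<subseteq> {..<t}" using assms(2) by auto
  then have "forceable t ?V"
    using forced_imp_forceable[OF fin _ b(1) _ forced0] assms(2) by simp
  then obtain c d where F: "forced ?V c d" and ct: "c ` ?V \<subseteq> {..<t}" and dt: "d ` ?V \<subseteq> {..<t}"
    by (auto simp: forceable_def)
  have pc: "proper ?V c" and dc: "\<And>v. v \<in> ?V \<Longrightarrow> d v \<noteq> c v"
    using F by (simp_all add: forced_def)
  define L where "L = (\<lambda>v. {c v, d v})"
  let ?U = "\<Union>v\<in>?V. L v"
  have Ut: "?U \<subseteq> {..<t}" using ct dt by (auto simp: L_def)
  then have finU: "finite ?U" using finite_subset by blast
  have cardL: "card (L v) = 2" if "v \<in> ?V" for v
    using dc[OF that] by (auto simp: L_def card_2_iff)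
  (* c uses at least as many colours as the chromatic number, and if only two colours were
     available, then all lists would coincide and all vertices could be switched. *)
  have "card ?U = t"
  proof (rule ccontr)
    assume "card ?U \<noteq> t"
    then have lt: "card ?U < t" using card_mono[OF _ Ut] by simp
    have "chromatic_number G \<le> card (c ` ?V)"
      unfolding chromatic_number_def using colorable_card[OF pc] by (rule Least_le)
    also have "\<dots> \<le> card ?U"
      by (rule card_mono[OF finU]) (auto simp: L_def)
    finally have U2: "card ?U \<le> 2" using lt assms(2) by simp
    have LU: "L v = ?U" if "v \<in> ?V" for v
      by (rule card_seteq[OF finU]) (use that U2 cardL in auto)
    obtain s where "s \<in> ?V" using ne by blast
    show False
    proof (rule forcedD[OF F, of ?V s])
      show "d u \<noteq> d v" if "u \<in> ?V" "v \<in> ?V" "E u v" for u v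
      proof -
        have "{c u, d u} = {c v, d v}" using LU[OF that(1)] LU[OF that(2)] by (simp add: L_def)
        moreover have "c u \<noteq> c v" by (rule properD[OF pc that])
        ultimately show ?thesis using dc[OF that(1)] by (auto simp: doubleton_eq_iff)
      qed
    qed (use \<open>s \<in> ?V\<close> in auto)
  qed
  then have "list_assignment 2 t G L"
    using assms(2) cardL by (simp add: list_assignment_def)
  moreover have "\<exists>!c'. c' \<in> list_colorings G L"
  proof
    have "proper ?V (restrict c ?V)" using pc by (simp add: proper_def)
    then show "restrict c ?V \<in> list_colorings G L"
      by (auto simp: list_colorings_def proper_iff L_def)
    fix c' assume c': "c' \<in> list_colorings G L"
    then have "proper ?V c'" "\<forall>v\<in>?V. c' v = c v \<or> c' v = d v"
      by (auto simp: list_colorings_def proper_iff L_def)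
    then have "\<forall>v\<in>?V. c' v = c v" using F unfolding forced_def by blast
    moreover have "c' \<in> extensional ?V"
      using c' by (auto simp: list_colorings_def PiE_def)
    ultimately show "c' = restrict c ?V"
      by (auto intro!: extensionalityI)
  qed
  ultimately show "uniquely_kt_list_colorable 2 t G"
    unfolding uniquely_kt_list_colorable_def by blast
qed

end
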